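(* Let $\Delta=\Delta(n)$ satisfy $2\leq\Delta(n)$ and $\Delta(n)=o(\sqrt n)$ as $n\to\infty$, and let $G$ be an $n$-vertex graph with minimum degree $\delta(G)\geq n-1-\Delta$. Then $$\operatorname{rig}(G)\geq\frac n2+\frac{n}{\Delta+1}-O(\sqrt n+\Delta^2).$$ That is, there are constants $C$ and $n_0$ such that for all $n\ge n_0$ and every $n$-vertex graph $G$ with $\delta(G)\ge n-1-\Delta(n)$ one has $\operatorname{rig}(G)\geq\frac n2+\frac{n}{\Delta(n)+1}-C(\sqrt n+\Delta(n)^2)$.
   Context: All graphs are finite and simple. A $d$-dimensional framework $(G,p)$ of a graph $G=(V,E)$ is given by a map $p:V\to\mathbb{R}^d$. It is rigid if every continuous motion of the vertices (starting at $p$) preserving the lengths of all edges preserves all pairwise distances between vertices. The map $p$ is generic if the $d|V|$ coordinates of the points $p(v)$, $v\in V$, are algebraically independent over $\mathbb{Q}$. $G$ is (generically) $d$-rigid if $(G,p)$ is rigid for some, equivalently every, generic $p:V\to\mathbb{R}^d$. Equivalently: either $G$ is a complete graph on at most $d+1$ vertices, or $|V|\ge d+1$ and for generic $p$ the rigidity matrix $R(G,p)$ has rank $d|V|-\binom{d+1}{2}$. Here $R(G,p)$ is the $|E|\times d|V|$ matrix whose row for the edge $uv$ has $p(u)-p(v)$ in the $d$ columns of $u$, $p(v)-p(u)$ in the $d$ columns of $v$, and zeros elsewhere. By convention every graph is $0$-rigid. For an $n$-vertex graph $G$, the rigidity dimension $\operatorname{rig}(G)$ is the largest nonnegative integer $d\le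 n-1$ for which $G$ is generically $d$-rigid. *)

theory Defs
  imports "HOL-Analysis.Analysis" "HOL-Library.Landau_Symbols" "HOL-Library.Poly_Mapping"
begin

definition simple_graph :: "'a set \<Rightarrow> 'a set set \<Rightarrow> bool" where
  "simple_graph V E \<longleftrightarrow> finite V \<and> (\<forall>e\<in>E. e \<subseteq> V \<and> card e = 2)"

definition vertex_degree :: "'a set set \<Rightarrow> 'a \<Rightarrow> nat" where
  "vertex_degree E v = card {e \<in> E. v \<in> e}"

definition min_degree :: "'a set \<Rightarrow> 'a set set \<Rightarrow> nat" where
  "min_degree V E = Min (vertex_degree E ` V)"

text \<open>
  Since the dimension \<open>d\<close> is quantified over in the definition of the rigidity dimension, a point
  of \<open>d\<close>-space is a function \<open>nat \<Rightarrow> real\<close> of which only the coordinates below \<open>d\<close> are ever used.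
\<close>

definition edist :: "nat \<Rightarrow> (nat \<Rightarrow> real) \<Rightarrow> (nat \<Rightarrow> real) \<Rightarrow> real" where
  "edist d x y = L2_set (\<lambda>i. x i - y i) {..<d}"

definition continuous_motion ::
    "nat \<Rightarrow> 'a set \<Rightarrow> ('a \<Rightarrow> nat \<Rightarrow> real) \<Rightarrow> (real \<Rightarrow> 'a \<Rightarrow> nat \<Rightarrow> real) \<Rightarrow> bool" where
  "continuous_motion d V p q \<longleftrightarrow>
     (\<forall>v\<in>V. \<forall>i<d. q 0 v i = p v i \<and> continuous_on {0..1} (\<lambda>t. q t v i))"

definition rigid_framework ::
    "nat \<Rightarrow> 'a set \<Rightarrow> 'a set set \<Rightarrow> ('a \<Rightarrow> nat \<Rightarrow> real) \<Rightarrow> bool" where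
  "rigid_framework d V E p \<longleftrightarrow>
     (\<forall>q. continuous_motion d V p q \<and>
          (\<forall>t\<in>{0..1}. \<forall>u v. {u, v} \<in> E \<longrightarrow> edist d (q t u) (q t v) = edist d (p u) (p v))
        \<longrightarrow> (\<forall>t\<in>{0..1}. \<forall>u\<in>V. \<forall>v\<in>V. edist d (q t u) (q t v) = edist d (p u) (p v)))"

text \<open>
  A polynomial with rational coefficients in variables indexed by \<open>'i\<close> is a finitely supported
  map from monomials (finitely supported exponent vectors) to coefficients.
\<close>

definition eval_rat_poly :: "('i \<Rightarrow> real) \<Rightarrow> (('i \<Rightarrow>\<^sub>0 nat) \<Rightarrow>\<^sub>0 rat) \<Rightarrow> real" where
  "eval_rat_poly x P =
     (\<Sum>m\<in>Poly_Mapping.keys P. of_rat (Poly_Mapping.lookup P m) * (\<Prod>i\<in>Poly_Mapping.keys m. x i ^ Poly_Mapping.lookup m i))"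

definition alg_independent_over_rat :: "'i set \<Rightarrow> ('i \<Rightarrow> real) \<Rightarrow> bool" where
  "alg_independent_over_rat I x \<longleftrightarrow>
     (\<forall>P. (\<forall>m\<in>Poly_Mapping.keys P. Poly_Mapping.keys m \<subseteq> I) \<and> eval_rat_poly x P = 0 \<longrightarrow> P = 0)"

definition generic :: "nat \<Rightarrow> 'a set \<Rightarrow> ('a \<Rightarrow> nat \<Rightarrow> real) \<Rightarrow> bool" where
  "generic d V p \<longleftrightarrow> alg_independent_over_rat (V \<times> {..<d}) (\<lambda>(v, i). p v i)"

definition generically_rigid :: "nat \<Rightarrow> 'a set \<Rightarrow> 'a set set \<Rightarrow> bool" where
  "generically_rigid d V E \<longleftrightarrow> (\<exists>p. generic d V p \<and> rigid_framework d V E p)"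

text \<open>The convention that every graph is \<open>0\<close>-rigid needs no separate clause:\<close>

lemma generically_rigid_0: "generically_rigid 0 V E"
proof -
  have "P = 0" if "\<forall>m\<in>Poly_Mapping.keys P. Poly_Mapping.keys m = {}" "eval_rat_poly x P = 0"
    for P :: "(('a \<times> nat) \<Rightarrow>\<^sub>0 nat) \<Rightarrow>\<^sub>0 rat" and x
  proof (rule ccontr)
    assume "P \<noteq> 0"
    moreover have "Poly_Mapping.keys P \<subseteq> {0}"
      using that(1) by auto
    ultimately have "Poly_Mapping.keys P = {0}"
      by (metis keys_eq_empty subset_singletonD)
    then have "eval_rat_poly x P = of_rat (Poly_Mapping.lookup P 0)" "Poly_Mapping.lookup P 0 \<noteq> 0"
      by (auto simp: eval_rat_poly_def simp flip: in_keys_iff)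
    with that(2) show False by simp
  qed
  then show ?thesis
    by (auto simp: generically_rigid_def generic_def alg_independent_over_rat_def
        rigid_framework_def edist_def)
qed

text \<open>
  The strict bound \<open>d < card V\<close> is \<open>d \<le> n - 1\<close>.  If \<open>V\<close> is empty, no \<open>d\<close> qualifies and the value
  is meaningless; otherwise \<open>d = 0\<close> qualifies, so the maximum exists.
\<close>

definition rigidity_dim :: "'a set \<Rightarrow> 'a set set \<Rightarrow> nat" where
  "rigidity_dim V E = (GREATEST d. d < card V \<and> generically_rigid d V E)"

end

theory Submission
  imports Defs
begin

text \<open>
  Let \<open>H\<close> be the complement of \<open>G\<close>; its maximum degree is at most \<open>\<Delta>\<close>.  Since \<open>\<Delta> \<ge> 2\<close>, it suffices
  to show that \<open>G\<close> is \<open>d\<close>-rigid for \<open>d = n - 1 - k\<close> with \<open>k = \<lfloor>n / 6\<rfloor>\<close>.  Because \<open>\<Delta>\<^sup>2 = o(n)\<close>, a greedy argument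
  gives a harmonious colouring of \<open>H\<close> with \<open>k\<close> colours: distinct edges of \<open>H\<close> receive distinct pairs of
  colours.  Place \<open>d + 1\<close> vertices at the vertices of a simplex and the remaining one of each colour
  class at the barycentre of the rest of its class.  The affine dependencies of this configuration are
  then spanned by one dependency \<open>Y\<^sub>j\<close> per colour \<open>j\<close>, supported on that colour class.

  If \<open>f(u, v) = (z\<^sub>u - z\<^sub>v) \<bullet> (x\<^sub>u - x\<^sub>v)\<close> and \<open>Y\<close>, \<open>Y'\<close> are affine dependencies of \<open>x\<close>, then
  \<open>\<Sum> Y(u) Y'(v) f(u, v) = 0\<close>.  When \<open>f\<close> is supported on \<open>H\<close>, harmoniousness makes each such sum with
  \<open>Y = Y\<^sub>i\<close>, \<open>Y' = Y\<^sub>j\<close> consist of at most one term, whence \<open>f = 0\<close>; an estimate of the error terms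
  extends this to all \<open>x\<close> whose Gram matrix is close to that of the special configuration, in
  particular to some generic ones.

  For motions no implicit function theorem is needed: for \<open>x = (p + q) / 2\<close> and \<open>z = q - p\<close> one has
  \<open>f(u, v) = (|q\<^sub>u - q\<^sub>v|\<^sup>2 - |p\<^sub>u - p\<^sub>v|\<^sup>2) / 2\<close>, so if \<open>p\<close> and \<open>q\<close> are close and have the same edge
  lengths, then they have the same distances.
\<close>

section \<open>Density of generic points\<close>

text \<open>A finitely supported map is determined by its graph over its support, a finite subset of
  a countable set. This serves both for monomials, as maps on variables, and for polynomials, as
  maps on monomials.\<close>

lemma countable_poly_mapping:
  fixes I :: "'i set"
  assumes "countable I"
  shows "countable {m :: 'i \<Rightarrow>\<^sub>0 'b::{zero,countable}. Poly_Mapping.keys m \<subseteq> I}" (is "countable ?S")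
proof -
  define g where "g m = (\<lambda>i. (i, Poly_Mapping.lookup m i)) ` Poly_Mapping.keys m"
    for m :: "'i \<Rightarrow>\<^sub>0 'b"
  have mem: "(i, r) \<in> g m \<longleftrightarrow> Poly_Mapping.lookup m i = r \<and> r \<noteq> 0" for i r m
    by (auto simp: g_def in_keys_iff)
  have "inj_on g ?S"
  proof (rule inj_onI)
    fix m m' assume "g m = g m'"
    then have "Poly_Mapping.lookup m i = Poly_Mapping.lookup m' i" for i
      using mem[of i _ m] mem[of i _ m'] by metis
    then show "m = m'" by (rule poly_mapping_eqI)
  qed
  moreover have "countable (g ` ?S)"
  proof (rule countable_subset)
    show "g ` ?S \<subseteq> {A. finite A \<and> A \<subseteq> I \<times> UNIV}"
      by (auto simp: g_def)
    show "countable {A :: ('i \<times> 'b) set. finite A \<and> A \<subseteq> I \<times> UNIV}"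
      using assms by (intro countable_Collect_finite_subset) auto
  qed
  ultimately show ?thesis
    by (simp add: countable_image_inj_eq)
qed

text \<open>Fixing all variables except \<open>j\<close> turns each nonzero polynomial over
  \<open>insert j I\<close> into a nonzero polynomial in one variable, which has finitely many
  roots. There are countably many such polynomials, so their roots cannot fill an interval.\<close>

lemma alg_independent_over_rat_extend:
  fixes x :: "'i \<Rightarrow> real"
  assumes ind: "alg_independent_over_rat I x" and "countable I" "j \<notin> I" "a < b"
  obtains t where "a < t" "t < b" "alg_independent_over_rat (insert j I) (x(j := t))"
proof -
  define Ps where "Ps = {P :: ('i \<Rightarrow>\<^sub>0 nat) \<Rightarrow>\<^sub>0 rat.
    Poly_Mapping.keys P \<subseteq> {m. Poly_Mapping.keys m \<subseteq> insert j I}}"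
  have "countable Ps"
    unfolding Ps_def using \<open>countable I\<close> by (intro countable_poly_mapping) auto
  define co where "co P m = real_of_rat (Poly_Mapping.lookup P m) *
      (\<Prod>i\<in>Poly_Mapping.keys m - {j}. x i ^ Poly_Mapping.lookup m i)"
    for P :: "('i \<Rightarrow>\<^sub>0 nat) \<Rightarrow>\<^sub>0 rat" and m
  define q where "q P = (\<Sum>m\<in>Poly_Mapping.keys P. monom (co P m) (Poly_Mapping.lookup m j))" for P
  have q_eval: "poly (q P) t = eval_rat_poly (x(j := t)) P" for P t
  proof -
    have "(\<Prod>i\<in>Poly_Mapping.keys m. (x(j := t)) i ^ Poly_Mapping.lookup m i)
       = (\<Prod>i\<in>Poly_Mapping.keys m - {j}. x i ^ Poly_Mapping.lookup m i) * t ^ Poly_Mapping.lookup m j"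
      for m
    proof (cases "j \<in> Poly_Mapping.keys m")
      case True
      then show ?thesis
        by (subst prod.remove[of _ j]) (auto simp: mult.commute intro!: prod.cong)
    next
      case False
      then show ?thesis
        by (auto simp: in_keys_iff intro!: prod.cong)
    qed
    then show ?thesis
      by (simp add: q_def eval_rat_poly_def poly_sum poly_monom co_def mult.assoc)
  qed
  have q_nz: "q P \<noteq> 0" if P: "P \<in> Ps" "P \<noteq> 0" for P
  proof -
    obtain m0 where m0: "m0 \<in> Poly_Mapping.keys P"
      using \<open>P \<noteq> 0\<close> by (metis all_not_in_conv keys_eq_empty)
    define e where "e = Poly_Mapping.lookup m0 j"
    let ?sh = "\<lambda>m. m + Poly_Mapping.single j e"
    \<comment> \<open>The coefficient of degree \<open>e\<close> in \<open>q P\<close> is again a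
      rational polynomial evaluated at \<open>x\<close>: take the monomials of \<open>P\<close> with
      exponent \<open>e\<close> at \<open>j\<close> and strip that power. Excluding \<open>j\<close>
      from the support of \<open>m\<close> makes the exponent exactly \<open>e\<close>. Independence
      over \<open>I\<close> then shows that the coefficient is nonzero.\<close>
    define L where "L m = (if j \<in> Poly_Mapping.keys m then 0 else Poly_Mapping.lookup P (?sh m))" for m
    have inj: "inj_on ?sh A" for A by (auto simp: inj_on_def)
    have "finite {m. ?sh m \<in> Poly_Mapping.keys P}"
      using finite_vimageI[of "Poly_Mapping.keys P" ?sh] inj by (auto simp: vimage_def)
    then have fin0: "finite {m. ?sh m \<in> Poly_Mapping.keys P}" .
    have "?sh m \<in> Poly_Mapping.keys P" if "L m \<noteq> 0" for m
      using that unfolding L_def in_keys_iff by metis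
    then have fin: "finite {m. L m \<noteq> 0}"
      by (intro finite_subset[OF _ fin0]) blast
    define Pe where "Pe = Abs_poly_mapping L"
    have lPe: "Poly_Mapping.lookup Pe m = L m" for m
      using fin by (simp add: Pe_def)
    have kPe: "Poly_Mapping.keys Pe = {m. j \<notin> Poly_Mapping.keys m \<and> ?sh m \<in> Poly_Mapping.keys P}"
      by (auto simp: in_keys_iff lPe L_def split: if_splits)
    have keys_sh: "Poly_Mapping.keys (?sh m) - {j} = Poly_Mapping.keys m" if "j \<notin> Poly_Mapping.keys m" for m
      using that by (auto simp: in_keys_iff lookup_add lookup_single when_def split: if_splits)
    have img: "?sh ` Poly_Mapping.keys Pe = {m \<in> Poly_Mapping.keys P. Poly_Mapping.lookup m j = e}"
    proof (intro set_eqI iffI)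
      fix m assume m: "m \<in> {m \<in> Poly_Mapping.keys P. Poly_Mapping.lookup m j = e}"
      have "m = ?sh (m - Poly_Mapping.single j e)"
        using m by (intro poly_mapping_eqI) (auto simp: lookup_add lookup_minus lookup_single when_def)
      moreover have "j \<notin> Poly_Mapping.keys (m - Poly_Mapping.single j e)"
        using m by (auto simp: in_keys_iff lookup_minus)
      ultimately show "m \<in> ?sh ` Poly_Mapping.keys Pe"
        using m unfolding kPe by (metis (mono_tags, lifting) image_eqI mem_Collect_eq)
    qed (auto simp: kPe lookup_add in_keys_iff)
    have "coeff (q P) e = (\<Sum>m | m \<in> Poly_Mapping.keys P \<and> Poly_Mapping.lookup m j = e. co P m)"
      by (simp add: q_def coeff_sum sum.If_cases Int_def)
    also have "\<dots> = (\<Sum>m\<in>Poly_Mapping.keys Pe. co P (?sh m))"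
      unfolding img[symmetric] by (subst sum.reindex[OF inj]) simp
    also have "\<dots> = eval_rat_poly x Pe"
      unfolding eval_rat_poly_def
    proof (rule sum.cong[OF refl])
      fix m assume m: "m \<in> Poly_Mapping.keys Pe"
      then have j: "j \<notin> Poly_Mapping.keys m" by (simp add: kPe)
      have "(\<Prod>i\<in>Poly_Mapping.keys (?sh m) - {j}. x i ^ Poly_Mapping.lookup (?sh m) i)
          = (\<Prod>i\<in>Poly_Mapping.keys m. x i ^ Poly_Mapping.lookup m i)"
        unfolding keys_sh[OF j] using j
        by (intro prod.cong) (auto simp: lookup_add lookup_single when_def)
      then show "co P (?sh m) = real_of_rat (Poly_Mapping.lookup Pe m) *
          (\<Prod>i\<in>Poly_Mapping.keys m. x i ^ Poly_Mapping.lookup m i)"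
        using j by (simp add: co_def lPe L_def)
    qed
    finally have "coeff (q P) e = eval_rat_poly x Pe" .
    moreover have "m0 \<in> ?sh ` Poly_Mapping.keys Pe"
      unfolding img using m0 by (simp add: e_def)
    then have "Pe \<noteq> 0" by auto
    moreover have "\<forall>m\<in>Poly_Mapping.keys Pe. Poly_Mapping.keys m \<subseteq> I"
    proof
      fix m assume m: "m \<in> Poly_Mapping.keys Pe"
      then have "Poly_Mapping.keys (?sh m) \<subseteq> insert j I"
        using P(1) by (auto simp: kPe Ps_def)
      then show "Poly_Mapping.keys m \<subseteq> I"
        using keys_sh[of m] m by (auto simp: kPe)
    qed
    ultimately have "coeff (q P) e \<noteq> 0"
      using ind unfolding alg_independent_over_rat_def by metis
    then show ?thesis by auto
  qed
  have "countable (\<Union>P\<in>Ps - {0}. {t. poly (q P) t = 0})"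
    using \<open>countable Ps\<close> q_nz
    by (intro countable_UN) (auto intro!: countable_finite poly_roots_finite)
  moreover have "uncountable {a<..<b}"
    using \<open>a < b\<close> uncountable_open_interval by blast
  ultimately obtain t where t: "t \<in> {a<..<b}" "t \<notin> (\<Union>P\<in>Ps - {0}. {t. poly (q P) t = 0})"
    by (meson countable_subset subsetI)
  have "alg_independent_over_rat (insert j I) (x(j := t))"
    unfolding alg_independent_over_rat_def using t(2) by (auto simp: q_eval Ps_def)
  with t(1) show ?thesis using that by auto
qed

lemma alg_independent_over_rat_empty: "alg_independent_over_rat {} x"
  unfolding alg_independent_over_rat_def
proof (intro allI impI)
  fix P :: "('a \<Rightarrow>\<^sub>0 nat) \<Rightarrow>\<^sub>0 rat"
  assume P: "(\<forall>m\<in>Poly_Mapping.keys P. Poly_Mapping.keys m \<subseteq> {}) \<and> eval_rat_poly x P = 0"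
  then have sub: "Poly_Mapping.keys P \<subseteq> {0}" by auto
  have "Poly_Mapping.keys P = {}"
  proof (rule ccontr)
    assume "Poly_Mapping.keys P \<noteq> {}"
    with sub have "Poly_Mapping.keys P = {0}" by (metis subset_singletonD)
    moreover from this have "Poly_Mapping.lookup P 0 \<noteq> 0"
      by (metis in_keys_iff insertI1)
    ultimately show False using P by (simp add: eval_rat_poly_def)
  qed
  then show "P = 0" by simp
qed

lemma alg_independent_over_rat_dense:
  fixes x0 :: "'i \<Rightarrow> real"
  assumes "finite I" "\<epsilon> > 0"
  shows "\<exists>x. alg_independent_over_rat I x \<and> (\<forall>i\<in>I. \<bar>x i - x0 i\<bar> < \<epsilon>)"
  using \<open>finite I\<close>
proof induction
  case empty
  show ?case using alg_independent_over_rat_empty by auto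
next
  case (insert j I)
  then obtain x where x: "alg_independent_over_rat I x" "\<forall>i\<in>I. \<bar>x i - x0 i\<bar> < \<epsilon>"
    by auto
  obtain t where "x0 j - \<epsilon> < t" "t < x0 j + \<epsilon>" "alg_independent_over_rat (insert j I) (x(j := t))"
    using alg_independent_over_rat_extend[OF x(1), of j "x0 j - \<epsilon>" "x0 j + \<epsilon>"] insert.hyps \<open>\<epsilon> > 0\<close>
    by (auto simp: countable_finite)
  moreover from this have "\<forall>i\<in>insert j I. \<bar>(x(j := t)) i - x0 i\<bar> < \<epsilon>"
    using x(2) insert.hyps by (auto simp: abs_less_iff)
  ultimately show ?case by blast
qed

lemma generic_dense:
  assumes "finite V" "\<epsilon> > 0"
  obtains p where "generic d V p" "\<And>v i. v \<in> V \<Longrightarrow> i < d \<Longrightarrow> \<bar>p v i - p0 v i\<bar> < \<epsilon>"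
proof -
  obtain x where x: "alg_independent_over_rat (V \<times> {..<d}) x"
      "\<forall>i\<in>V \<times> {..<d}. \<bar>x i - (\<lambda>(v, i). p0 v i) i\<bar> < \<epsilon>"
    using alg_independent_over_rat_dense[of "V \<times> {..<d}" \<epsilon> "\<lambda>(v, i). p0 v i"] assms by auto
  show ?thesis
    by (rule that[of "\<lambda>v i. x (v, i)"]) (use x in \<open>auto simp: generic_def\<close>)
qed

section \<open>Harmonious colourings\<close>

text \<open>
  The second clause (vertices with a common neighbour get different colours) follows from the first
  when \<open>A\<close> is everything; for a partial colouring it keeps uncoloured common neighbours colourable.
\<close>

definition harmonious_on :: "('a \<Rightarrow> 'a set) \<Rightarrow> 'a set \<Rightarrow> ('a \<Rightarrow> nat) \<Rightarrow> bool" where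
  "harmonious_on N A c \<longleftrightarrow>
     (\<forall>u\<in>A. \<forall>v\<in>A \<inter> N u. \<forall>u'\<in>A. \<forall>v'\<in>A \<inter> N u'. c u = c u' \<and> c v = c v' \<longrightarrow> u = u' \<and> v = v') \<and>
     (\<forall>u\<in>A. \<forall>u'\<in>A. u \<noteq> u' \<and> N u \<inter> N u' \<noteq> {} \<longrightarrow> c u \<noteq> c u')"

text \<open>\<open>x\<close> and \<open>y\<close> clash if giving them the same colour could violate harmoniousness.\<close>

definition clash :: "('a \<Rightarrow> 'a set) \<Rightarrow> 'a set \<Rightarrow> ('a \<Rightarrow> nat) \<Rightarrow> 'a \<Rightarrow> 'a \<Rightarrow> bool" where
  "clash N A c x y \<longleftrightarrow> y \<in> N x \<or> N x \<inter> N y \<noteq> {} \<or> (\<exists>u\<in>A \<inter> N x. \<exists>u'\<in>A \<inter> N y. c u = c u')"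

locale bounded_degree =
  fixes V :: "'a set" and N :: "'a \<Rightarrow> 'a set" and \<Delta> :: nat
  assumes finite_V: "finite V"
    and N_sub: "\<And>v. N v \<subseteq> V"
    and N_sym: "\<And>u v. u \<in> N v \<Longrightarrow> v \<in> N u"
    and N_irrefl: "\<And>v. v \<notin> N v"
    and card_N: "\<And>v. card (N v) \<le> \<Delta>"
begin

lemma finite_N: "finite (N v)"
  using N_sub finite_V finite_subset by blast

lemma clash_sym: "clash N A c x y \<Longrightarrow> clash N A c y x"
  unfolding clash_def using N_sym by (metis Int_commute)

text \<open>The three clauses of \<open>clash\<close> lead from \<open>x\<close> to \<open>y\<close>
  by one edge, by two edges, or by an edge, a change of vertex within a colour class, and another
  edge. They contribute at most \<open>\<Delta>\<close>, \<open>\<Delta>\<^sup>2\<close> and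
  \<open>s * \<Delta>\<^sup>2\<close> vertices.\<close>

lemma card_clash:
  assumes "A \<subseteq> V" and s: "\<And>j. card {v \<in> A. c v = j} \<le> s"
  shows "card {y. clash N A c x y} \<le> (s + 2) * \<Delta>\<^sup>2" "finite {y. clash N A c x y}"
proof -
  have finA: "finite A" using assms finite_V finite_subset by blast
  let ?B = "\<lambda>u. {u' \<in> A. c u' = c u}"
  let ?T = "N x \<union> (\<Union>u\<in>N x. N u) \<union> (\<Union>u\<in>N x. \<Union>u'\<in>?B u. N u')"
  have sub: "{y. clash N A c x y} \<subseteq> ?T"
  proof
    fix y assume "y \<in> {y. clash N A c x y}"
    then consider "y \<in> N x" | z where "z \<in> N x" "z \<in> N y"
      | u u' where "u \<in> A" "u \<in> N x" "u' \<in> A" "u' \<in> N y" "c u' = c u"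
      by (auto simp: clash_def)
    then show "y \<in> ?T"
    proof cases
      case 2
      then show ?thesis using N_sym[of z y] by blast
    next
      case 3
      then have "y \<in> (\<Union>u\<in>N x. \<Union>u'\<in>?B u. N u')"
        using N_sym[of u' y] by blast
      then show ?thesis by blast
    qed blast
  qed
  have fin: "finite ?T"
    using finite_N finA by (intro finite_UnI finite_UN_I) auto
  show "finite {y. clash N A c x y}" using sub fin finite_subset by blast
  have 1: "card (\<Union>u\<in>N x. N u) \<le> \<Delta> * \<Delta>"
  proof -
    have "card (\<Union>u\<in>N x. N u) \<le> (\<Sum>u\<in>N x. card (N u))" by (rule card_UN_le[OF finite_N])
    also have "\<dots> \<le> card (N x) * \<Delta>" using card_N by (intro sum_bounded_above[where K = "\<Delta>", simplified]) auto
    finally show ?thesis using card_N[of x] by (meson mult_le_mono1 order_trans)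
  qed
  have 2: "card (\<Union>u'\<in>?B u. N u') \<le> s * \<Delta>" for u
  proof -
    have "card (\<Union>u'\<in>?B u. N u') \<le> (\<Sum>u'\<in>?B u. card (N u'))" by (rule card_UN_le) (use finA in auto)
    also have "\<dots> \<le> card (?B u) * \<Delta>" using card_N by (intro sum_bounded_above[where K = "\<Delta>", simplified]) auto
    finally show ?thesis using s[of "c u"] by (meson mult_le_mono1 order_trans)
  qed
  have 3: "card (\<Union>u\<in>N x. \<Union>u'\<in>?B u. N u') \<le> \<Delta> * (s * \<Delta>)"
  proof -
    have "card (\<Union>u\<in>N x. \<Union>u'\<in>?B u. N u') \<le> (\<Sum>u\<in>N x. card (\<Union>u'\<in>?B u. N u'))"
      by (rule card_UN_le[OF finite_N])
    also have "\<dots> \<le> card (N x) * (s * \<Delta>)" using 2 by (intro sum_bounded_above[where K = "(s * \<Delta>)", simplified]) auto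
    finally show ?thesis using card_N[of x] by (meson mult_le_mono1 order_trans)
  qed
  have "card {y. clash N A c x y} \<le> card ?T" using sub fin by (rule card_mono[rotated])
  also have "\<dots> \<le> card (N x) + card (\<Union>u\<in>N x. N u) + card (\<Union>u\<in>N x. \<Union>u'\<in>?B u. N u')"
    by (meson add_mono card_Un_le le_refl order_trans)
  also have "\<dots> \<le> \<Delta> + \<Delta> * \<Delta> + \<Delta> * (s * \<Delta>)"
    using 1 3 card_N[of x] by linarith
  also have "\<dots> \<le> (s + 2) * \<Delta>\<^sup>2"
    by (cases \<Delta>) (auto simp: power2_eq_square algebra_simps)
  finally show "card {y. clash N A c x y} \<le> (s + 2) * \<Delta>\<^sup>2" .
qed

text \<open>A new violation must involve \<open>v\<close>. If \<open>v\<close> is at the same end of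
  both edges, the other ends share the neighbour \<open>v\<close> and the second clause of
  \<open>harmonious_on\<close> applies; in all other positions the colour \<open>j\<close> would be
  repeated on a clashing vertex.\<close>

lemma harmonious_on_extend:
  assumes h: "harmonious_on N A c" and "v \<notin> A"
    and ok: "\<And>y. y \<in> A \<Longrightarrow> c y = j \<Longrightarrow> \<not> clash N A c v y"
  shows "harmonious_on N (insert v A) (c(v := j))"
proof -
  let ?c = "c(v := j)"
  have h1: "u = u' \<and> v = v'" if "u \<in> A" "v \<in> A" "u' \<in> A" "v' \<in> A" "v \<in> N u" "v' \<in> N u'" "c u = c u'" "c v = c v'"
    for u v u' v' using h that unfolding harmonious_on_def by blast
  have h2: "u = u'" if "u \<in> A" "u' \<in> A" "c u = c u'" "x \<in> N u" "x \<in> N u'" for u u' x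
    using h that unfolding harmonious_on_def by blast
  have ok1: "c y \<noteq> j" if "y \<in> A" "y \<in> N v" for y
    using ok[OF that(1)] that by (auto simp: clash_def)
  have ok2: "c y \<noteq> j" if "y \<in> A" "x \<in> N v" "x \<in> N y" for x y
    using ok[OF that(1)] that by (auto simp: clash_def)
  have ok3: "c y \<noteq> j" if "y \<in> A" "u \<in> A" "u \<in> N v" "u' \<in> A" "u' \<in> N y" "c u = c u'" for y u u'
    using ok[OF that(1)] that by (auto simp: clash_def)
  have key: False if "b \<in> A" "b \<in> N v" "u' \<in> A" "v' \<in> insert v A" "v' \<in> N u'" "j = c u'" "c b = ?c v'" for b u' v'
  proof (cases "v' = v")
    case True
    then show False using ok1[of u'] N_sym that by auto
  next
    case False
    then show False using ok3[of u' b v'] that by auto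
  qed
  have "a = a' \<and> b = b'" if *: "a \<in> insert v A" "b \<in> insert v A" "b \<in> N a"
      "a' \<in> insert v A" "b' \<in> insert v A" "b' \<in> N a'" "?c a = ?c a'" "?c b = ?c b'" for a b a' b'
  proof -
    \<comment> \<open>If \<open>v\<close> is the first end of one edge, \<open>key\<close> makes it
      the first end of the other. Reversing both edges gives the same for the second ends.\<close>
    have k: "a = v \<longleftrightarrow> a' = v" if *: "a \<in> insert v A" "b \<in> insert v A" "b \<in> N a"
      "a' \<in> insert v A" "b' \<in> insert v A" "b' \<in> N a'" "?c a = ?c a'" "?c b = ?c b'" for a b a' b'
    proof -
      have "False" if "a = v" "a' \<noteq> v"
      proof -
        have "b \<noteq> v" using N_irrefl * that by auto
        then show False using key[of b a' b'] * that by auto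
      qed
      moreover have "False" if "a' = v" "a \<noteq> v"
      proof -
        have "b' \<noteq> v" using N_irrefl * that by auto
        then show False using key[of b' a b] * that by auto
      qed
      ultimately show ?thesis by blast
    qed
    have ka: "a = v \<longleftrightarrow> a' = v" by (rule k[of a b a' b']) (use * in auto)
    have kb: "b = v \<longleftrightarrow> b' = v" by (rule k[of b a b' a']) (use * N_sym in auto)
    consider "a = v" | "b = v" | "a \<noteq> v" "b \<noteq> v" by blast
    then show ?thesis
    proof cases
      case 1
      then have "b \<noteq> v" using * N_irrefl by auto
      then show ?thesis using 1 ka kb * h2[of b b' v] N_sym[of b v] N_sym[of b' v] by simp
    next
      case 2
      then have "a \<noteq> v" using * N_irrefl by auto
      then show ?thesis using 2 ka kb * h2[of a a' v] by simp
    next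
      case 3
      then show ?thesis using ka kb * h1[of a b a' b'] by simp
    qed
  qed
  moreover have "?c u \<noteq> ?c u'" if "u \<in> insert v A" "u' \<in> insert v A" "u \<noteq> u'" "x \<in> N u" "x \<in> N u'" for u u' x
    using that h2[of u u' x] ok2[of u x] ok2[of u' x] by (auto split: if_splits)
  ultimately show ?thesis unfolding harmonious_on_def by blast
qed

lemma class_insert:
  assumes "v \<notin> A"
  shows "{u \<in> insert v A. (c(v := j)) u = i} = (if i = j then insert v {u \<in> A. c u = i} else {u \<in> A. c u = i})"
  using assms by auto

text \<open>Seeding every colour with two non-clashing vertices guarantees classes large enough for
  both a tip and a nonempty rest. While classes have size at most 2, a vertex clashes with at most
  \<open>4 * \<Delta>\<^sup>2\<close> others, so a partner for \<open>x\<close> remains.\<close>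

lemma harmonious_pairs:
  assumes "2 * k + 4 * \<Delta>\<^sup>2 \<le> card V"
  shows "\<exists>A c. A \<subseteq> V \<and> card A = 2 * k \<and> c ` A \<subseteq> {..<k} \<and> harmonious_on N A c \<and>
           (\<forall>j<k. card {v \<in> A. c v = j} = 2)"
  using assms
proof (induction k)
  case 0
  show ?case by (intro exI[of _ "{}"]) (auto simp: harmonious_on_def)
next
  case (Suc k)
  then obtain A c where A: "A \<subseteq> V" "card A = 2 * k" "c ` A \<subseteq> {..<k}" "harmonious_on N A c"
      "\<forall>j<k. card {v \<in> A. c v = j} = 2" by auto
  have finA: "finite A" using A finite_V finite_subset by blast
  have "card A < card V" using A Suc.prems by simp
  then obtain x where x: "x \<in> V" "x \<notin> A"
    using A(1) by (metis less_irrefl subsetI subset_antisym)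
  let ?A = "insert x A" and ?c = "c(x := k)"
  have h: "harmonious_on N ?A ?c"
    using A x by (intro harmonious_on_extend) auto
  have le2: "card {v \<in> ?A. ?c v = j} \<le> 2" for j
  proof -
    have "{v \<in> A. c v = j} = {}" if "\<not> j < k" using A(3) that by auto
    then consider "j < k" "card {v \<in> A. c v = j} = 2" | "{v \<in> A. c v = j} = {}"
      using A(5) by blast
    then show ?thesis
    proof cases
      case 1
      then show ?thesis unfolding class_insert[OF x(2)] by simp
    next
      case 2
      show ?thesis unfolding class_insert[OF x(2)] 2 by simp
    qed
  qed
  have "?A \<subseteq> V" using A(1) x(1) by simp
  note cl = card_clash[OF this le2, of x]
  have "card (?A \<union> {y. clash N ?A ?c x y}) \<le> card ?A + (2 + 2) * \<Delta>\<^sup>2"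
    using cl card_Un_le[of ?A "{y. clash N ?A ?c x y}"] by linarith
  also have "\<dots> < card V" using Suc.prems A x finA by simp
  finally have "\<not> V \<subseteq> ?A \<union> {y. clash N ?A ?c x y}"
    using card_mono[of "?A \<union> {y. clash N ?A ?c x y}" V] cl(2) finA by auto
  then obtain y where y: "y \<in> V" "y \<notin> ?A" "\<not> clash N ?A ?c x y" by auto
  let ?B = "insert y ?A" and ?d = "?c(y := k)"
  have "harmonious_on N ?B ?d"
  proof (rule harmonious_on_extend[OF h y(2)])
    fix z assume "z \<in> ?A" "?c z = k"
    then have "z = x" using A(3) by (force split: if_splits)
    then show "\<not> clash N ?A ?c y z" using y(3) clash_sym by blast
  qed
  moreover have "card {v \<in> ?B. ?d v = j} = 2" if "j < Suc k" for j
  proof (cases "j = k")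
    case True
    have e: "{v \<in> A. c v = k} = {}" using A by auto
    show ?thesis unfolding class_insert[OF y(2)] class_insert[OF x(2)] True e
      using y by simp
  next
    case False
    then show ?thesis unfolding class_insert[OF y(2)] class_insert[OF x(2)]
      using that A(5) by auto
  qed
  moreover have "?B \<subseteq> V" "card ?B = 2 * Suc k" using A x y finA by auto
  moreover have "?d ` ?B \<subseteq> {..<Suc k}" using A by auto
  ultimately show ?case by blast
qed

text \<open>Greedy colouring with class sizes capped at \<open>s\<close>: at most
  \<open>card V / s\<close> colours are full, and at most \<open>(s + 2) * \<Delta>\<^sup>2\<close>
  are blocked by a clash. The bound on \<open>k\<close> leaves a usable colour.\<close>

lemma harmonious_complete:
  assumes "A \<subseteq> V" "c ` A \<subseteq> {..<k}" "harmonious_on N A c"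
    and "\<And>j. card {v \<in> A. c v = j} \<le> s" "\<And>j. j < k \<Longrightarrow> 2 \<le> card {v \<in> A. c v = j}"
    and k: "card V + s * (s + 2) * \<Delta>\<^sup>2 < s * k"
  shows "\<exists>c. c ` V \<subseteq> {..<k} \<and> harmonious_on N V c \<and> (\<forall>j<k. 2 \<le> card {v \<in> V. c v = j})"
  using assms(1-5)
proof (induction "card (V - A)" arbitrary: A c)
  case 0
  then have "A = V" using finite_V by auto
  then show ?case using "0.prems"(2,3,5) by (intro exI[of _ c]) simp
next
  case (Suc m)
  then obtain v where v: "v \<in> V" "v \<notin> A"
    by (metis Diff_eq_empty_iff card.empty nat.distinct(1) subsetI)
  have finA: "finite A" using Suc.prems finite_V finite_subset by blast
  let ?X = "{y. clash N A c v y}"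
  let ?F = "{j \<in> {..<k}. card {v \<in> A. c v = j} = s}"
  have "s * card ?F = (\<Sum>j\<in>?F. card {v \<in> A. c v = j})" by simp
  also have "\<dots> = card (\<Union>j\<in>?F. {v \<in> A. c v = j})"
    by (rule card_UN_disjoint[symmetric]) (use finA in auto)
  also have "\<dots> \<le> card V"
    by (rule card_mono[OF finite_V]) (use Suc.prems in auto)
  finally have F: "s * card ?F \<le> card V" .
  have X: "card (c ` ?X) \<le> (s + 2) * \<Delta>\<^sup>2" "finite (c ` ?X)"
    using card_clash[OF Suc.prems(1,4), of v] card_image_le[of ?X c] by (blast intro: le_trans)+
  have "s * card (?F \<union> c ` ?X) \<le> s * (card ?F + (s + 2) * \<Delta>\<^sup>2)"
    using X card_Un_le[of ?F "c ` ?X"] by (intro mult_le_mono2) linarith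
  also have "\<dots> < s * k" using F k by (simp add: algebra_simps)
  finally have "card (?F \<union> c ` ?X) < card {..<k}" by auto
  then have "\<not> {..<k} \<subseteq> ?F \<union> c ` ?X"
    using card_mono[of "?F \<union> c ` ?X" "{..<k}"] X(2) by auto
  then obtain j where j: "j < k" "j \<notin> ?F" "j \<notin> c ` ?X" by auto
  let ?A = "insert v A" and ?c = "c(v := j)"
  have "card (V - ?A) = m"
    unfolding Diff_insert[of V v A] using Suc.hyps(2) v by (simp add: card_Diff_singleton)
  moreover have "?A \<subseteq> V" "?c ` ?A \<subseteq> {..<k}" using Suc.prems v j by auto
  moreover have "harmonious_on N ?A ?c"
    using j(3) by (intro harmonious_on_extend Suc.prems v) auto
  moreover have "card {u \<in> ?A. ?c u = i} \<le> s" for i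
  proof (cases "i = j")
    case True
    have "card {u \<in> A. c u = j} < s"
      using j Suc.prems(4)[of j] by (auto simp: le_less)
    then show ?thesis unfolding class_insert[OF v(2)] using True v finA by (simp add: card_insert_if)
  next
    case False
    then show ?thesis unfolding class_insert[OF v(2)] using Suc.prems(4)[of i] by simp
  qed
  moreover have "2 \<le> card {u \<in> ?A. ?c u = i}" if "i < k" for i
  proof -
    have "card {u \<in> A. c u = i} \<le> card {u \<in> ?A. ?c u = i}"
      by (rule card_mono) (use finA v in auto)
    then show ?thesis using Suc.prems(5)[OF that] by linarith
  qed
  ultimately show ?case
    by (intro Suc.hyps(1)[of ?A ?c]) simp_all
qed

lemma harmonious_colouring:
  assumes "s \<ge> 2" "card V + s * (s + 2) * \<Delta>\<^sup>2 < s * k" "2 * k + 4 * \<Delta>\<^sup>2 \<le> card V"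
  shows "\<exists>c. c ` V \<subseteq> {..<k} \<and> harmonious_on N V c \<and> (\<forall>j<k. 2 \<le> card {v \<in> V. c v = j})"
proof -
  obtain A c where A: "A \<subseteq> V" "c ` A \<subseteq> {..<k}" "harmonious_on N A c"
      "\<forall>j<k. card {v \<in> A. c v = j} = 2" using harmonious_pairs[OF assms(3)] by blast
  have "card {v \<in> A. c v = j} \<le> s" for j
  proof (cases "j < k")
    case False
    then have "{v \<in> A. c v = j} = {}" using A(2) by auto
    then show ?thesis by (metis card.empty le0)
  qed (use A \<open>s \<ge> 2\<close> in auto)
  then show ?thesis using harmonious_complete[OF A(1-3) _ _ assms(2)] A(4) by auto
qed

end

section \<open>Affine dependencies and infinitesimal rigidity\<close>

text \<open>Gaussian elimination: a pivot \<open>w\<close> clears coordinate \<open>d\<close> from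
  the other vectors, induction handles these, and the weight of \<open>w\<close> is recovered from
  the multiples subtracted.\<close>

lemma exists_linear_dependency:
  fixes x :: "'a \<Rightarrow> nat \<Rightarrow> real"
  assumes "finite S" "d < card S"
  shows "\<exists>Y. (\<forall>v. v \<notin> S \<longrightarrow> Y v = 0) \<and> (\<exists>v\<in>S. Y v \<noteq> 0) \<and> (\<forall>i<d. (\<Sum>v\<in>S. Y v * x v i) = 0)"
  using assms
proof (induction d arbitrary: S x)
  case 0
  then obtain v where "v \<in> S" by fastforce
  then show ?case by (intro exI[of _ "\<lambda>u. if u = v then 1 else 0"]) auto
next
  case (Suc d)
  show ?case
  proof (cases "\<forall>v\<in>S. x v d = 0")
    case True
    obtain Y where "\<forall>v. v \<notin> S \<longrightarrow> Y v = 0" "\<exists>v\<in>S. Y v \<noteq> 0"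
        "\<forall>i<d. (\<Sum>v\<in>S. Y v * x v i) = 0"
      using Suc.IH[of S x] Suc.prems by auto
    then show ?thesis using True by (intro exI[of _ Y]) (auto simp: less_Suc_eq)
  next
    case False
    then obtain w where w: "w \<in> S" "x w d \<noteq> 0" by blast
    define r where "r v = x v d / x w d" for v
    define x' where "x' v i = x v i - r v * x w i" for v i
    have "d < card (S - {w})" "finite (S - {w})" using Suc.prems w by auto
    from Suc.IH[OF this(2,1), of x'] obtain Z where
      Z: "\<forall>v. v \<notin> S - {w} \<longrightarrow> Z v = 0" "\<exists>v\<in>S - {w}. Z v \<noteq> 0"
         "\<forall>i<d. (\<Sum>v\<in>S - {w}. Z v * x' v i) = 0" by blast
    define Y where "Y = Z(w := - (\<Sum>v\<in>S - {w}. Z v * r v))"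
    have "(\<Sum>v\<in>S. Y v * x v i) = (\<Sum>v\<in>S - {w}. Z v * x' v i)" for i
    proof -
      have "(\<Sum>v\<in>S. Y v * x v i) = Y w * x w i + (\<Sum>v\<in>S - {w}. Y v * x v i)"
        using Suc.prems w by (simp add: sum.remove)
      also have "(\<Sum>v\<in>S - {w}. Y v * x v i) = (\<Sum>v\<in>S - {w}. Z v * x v i)"
        by (rule sum.cong) (auto simp: Y_def)
      also have "Y w * x w i = - (\<Sum>v\<in>S - {w}. Z v * r v * x w i)"
        by (simp add: Y_def sum_distrib_right)
      finally show ?thesis
        by (simp add: x'_def algebra_simps sum_subtractf)
    qed
    moreover have "x' v d = 0" for v using w by (simp add: x'_def r_def)
    ultimately have "(\<Sum>v\<in>S. Y v * x v i) = 0" if "i < Suc d" for i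
      using Z(3) that by (cases "i = d") auto
    moreover have "\<exists>v\<in>S. Y v \<noteq> 0" using Z(2) by (auto simp: Y_def)
    moreover have "\<forall>v. v \<notin> S \<longrightarrow> Y v = 0" using Z(1) w by (auto simp: Y_def)
    ultimately show ?thesis by blast
  qed
qed

text \<open>Homogenisation: an extra coordinate equal to 1 makes linear dependencies affine.\<close>

lemma exists_affine_dependency:
  fixes x :: "'a \<Rightarrow> nat \<Rightarrow> real"
  assumes "finite S" "d + 1 < card S"
  obtains Y where "\<And>v. v \<notin> S \<Longrightarrow> Y v = 0" "\<exists>v\<in>S. Y v \<noteq> 0" "(\<Sum>v\<in>S. Y v) = 0"
    "\<And>i. i < d \<Longrightarrow> (\<Sum>v\<in>S. Y v * x v i) = 0"
proof -
  obtain Y where Y: "\<forall>v. v \<notin> S \<longrightarrow> Y v = 0" "\<exists>v\<in>S. Y v \<noteq> 0"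
     "\<forall>i<Suc d. (\<Sum>v\<in>S. Y v * (if i = d then 1 else x v i)) = 0"
    using exists_linear_dependency[of S "Suc d" "\<lambda>v i. if i = d then 1 else x v i"] assms by auto
  have "(\<Sum>v\<in>S. Y v) = 0" using Y(3) by (auto dest: spec[of _ d])
  moreover have "(\<Sum>v\<in>S. Y v * x v i) = 0" if "i < d" for i
    using Y(3) that by (auto dest: spec[of _ i])
  ultimately show ?thesis using that Y by blast
qed

text \<open>The Gram matrix of the points, with \<open>b\<close> taken as the origin.\<close>

definition rel_inner :: "nat \<Rightarrow> 'a \<Rightarrow> ('a \<Rightarrow> nat \<Rightarrow> real) \<Rightarrow> 'a \<Rightarrow> 'a \<Rightarrow> real" where
  "rel_inner d b x u v = (\<Sum>i<d. (x u i - x b i) * (x v i - x b i))"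

text \<open>Half the derivative of the squared distance when \<open>x\<close> moves with velocity
  \<open>z\<close>.\<close>

definition length_velocity ::
    "nat \<Rightarrow> ('a \<Rightarrow> nat \<Rightarrow> real) \<Rightarrow> ('a \<Rightarrow> nat \<Rightarrow> real) \<Rightarrow> 'a \<Rightarrow> 'a \<Rightarrow> real" where
  "length_velocity d x z u v = (\<Sum>i<d. (z u i - z v i) * (x u i - x v i))"

text \<open>In each coordinate the product expands into four terms, and each factors into two sums,
  one of which pairs \<open>Y\<close> or \<open>Y'\<close> with 1 or with \<open>x\<close> and so
  vanishes.\<close>

lemma length_velocity_orthogonal:
  assumes Y: "(\<Sum>v\<in>V. Y v) = 0" "\<And>i. i < d \<Longrightarrow> (\<Sum>v\<in>V. Y v * x v i) = 0"
    and Y': "(\<Sum>v\<in>V. Y' v) = 0" "\<And>i. i < d \<Longrightarrow> (\<Sum>v\<in>V. Y' v * x v i) = (0::real)"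
  shows "(\<Sum>u\<in>V. \<Sum>v\<in>V. Y u * Y' v * length_velocity d x z u v) = 0"
proof -
  have "(\<Sum>u\<in>V. \<Sum>v\<in>V. Y u * Y' v * ((z u i - z v i) * (x u i - x v i))) = 0" if "i < d" for i
  proof -
    have "(\<Sum>u\<in>V. \<Sum>v\<in>V. Y u * Y' v * ((z u i - z v i) * (x u i - x v i)))
      = (\<Sum>u\<in>V. Y u * z u i * x u i) * (\<Sum>v\<in>V. Y' v)
      - (\<Sum>u\<in>V. Y u * z u i) * (\<Sum>v\<in>V. Y' v * x v i)
      - (\<Sum>u\<in>V. Y u * x u i) * (\<Sum>v\<in>V. Y' v * z v i)
      + (\<Sum>u\<in>V. Y u) * (\<Sum>v\<in>V. Y' v * z v i * x v i)"
      unfolding sum_product sum_subtractf[symmetric] sum.distrib[symmetric]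
      by (intro sum.cong refl) (simp add: algebra_simps)
    then show ?thesis using Y Y' that by simp
  qed
  then have "(\<Sum>i<d. \<Sum>u\<in>V. \<Sum>v\<in>V. Y u * Y' v * ((z u i - z v i) * (x u i - x v i))) = 0"
    by simp
  also have "(\<Sum>i<d. \<Sum>u\<in>V. \<Sum>v\<in>V. Y u * Y' v * ((z u i - z v i) * (x u i - x v i)))
    = (\<Sum>u\<in>V. \<Sum>v\<in>V. Y u * Y' v * length_velocity d x z u v)"
    unfolding length_velocity_def sum_distrib_left
    by (subst sum.swap, intro sum.cong refl, rule sum.swap)
  finally show ?thesis .
qed

text \<open>This allows dependencies of different configurations to be compared through their Gram
  matrices alone, which see only distances.\<close>

lemma rel_inner_dependency:
  assumes Y: "(\<Sum>v\<in>V. Y v) = 0" "\<And>i. i < d \<Longrightarrow> (\<Sum>v\<in>V. Y v * x v i) = 0"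
  shows "(\<Sum>v\<in>V. Y v * rel_inner d b x u v) = 0"
proof -
  have "(\<Sum>v\<in>V. Y v * rel_inner d b x u v) = (\<Sum>i<d. (x u i - x b i) * (\<Sum>v\<in>V. Y v * (x v i - x b i)))"
    unfolding rel_inner_def sum_distrib_left by (subst sum.swap) (simp add: algebra_simps)
  also have "\<dots> = 0"
    using Y by (intro sum.neutral) (auto simp: algebra_simps sum_subtractf simp flip: sum_distrib_left sum_distrib_right)
  finally show ?thesis .
qed

text \<open>
  \<open>H\<close> is the adjacency relation of the complement graph.  The vertices in \<open>base\<close> form a simplex with
  \<open>origin\<close> at \<open>0\<close> and the others at unit vectors; each \<open>tip j\<close> sits at the barycentre of \<open>rest j\<close>.
\<close>

locale collapsed_simplex =
  fixes V :: "'a set" and c :: "'a \<Rightarrow> nat" and H :: "'a \<Rightarrow> 'a \<Rightarrow> bool" and k d :: nat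
  assumes finite_V: "finite V" and colours: "c ` V \<subseteq> {..<k}"
    and class_ge_2: "\<And>j. j < k \<Longrightarrow> 2 \<le> card {v \<in> V. c v = j}"
    and H_colours: "\<And>u v u' v'. \<lbrakk>u \<in> V; v \<in> V; u' \<in> V; v' \<in> V; H u v; H u' v'; c u = c u'; c v = c v'\<rbrakk>
       \<Longrightarrow> u = u' \<and> v = v'"
    and card_V: "card V = d + 1 + k"
begin

section \<open>The special configuration and the stability of its affine dependencies\<close>

definition tip :: "nat \<Rightarrow> 'a" where "tip j = (SOME v. v \<in> V \<and> c v = j)"

definition base :: "'a set" where "base = V - tip ` {..<k}"

definition origin :: 'a where "origin = (SOME v. v \<in> base)"

definition axis :: "'a \<Rightarrow> nat" where "axis = (SOME f. bij_betw f (base - {origin}) {..<d})"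

definition rest :: "nat \<Rightarrow> 'a set" where "rest j = {v \<in> V. c v = j} - {tip j}"

definition vertex :: "'a \<Rightarrow> nat \<Rightarrow> real" where
  "vertex v i = (if v \<noteq> origin \<and> axis v = i then 1 else 0)"

definition config :: "'a \<Rightarrow> nat \<Rightarrow> real" where
  "config v i = (if v \<in> base then vertex v i
     else (\<Sum>u\<in>rest (c v). vertex u i) / card (rest (c v)))"

text \<open>The dependency of colour \<open>j\<close> expressing the tip as a barycentre, normalised
  to weight 1 at the tip.\<close>

definition dep :: "nat \<Rightarrow> 'a \<Rightarrow> real" where
  "dep j v = (if v = tip j then 1 else if v \<in> rest j then - 1 / card (rest j) else 0)"

lemma tip: assumes "j < k" shows "tip j \<in> V" "c (tip j) = j"
proof -
  have "{v \<in> V. c v = j} \<noteq> {}" using class_ge_2[OF assms] by force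
  then have "\<exists>v. v \<in> V \<and> c v = j" by blast
  from someI_ex[OF this] show "tip j \<in> V" "c (tip j) = j" by (auto simp: tip_def)
qed

lemma inj_tip: "inj_on tip {..<k}"
  by (metis inj_onI lessThan_iff tip(2))

lemma base_sub: "base \<subseteq> V" and finite_base: "finite base"
  using finite_V by (auto simp: base_def)

lemma card_base: "card base = d + 1"
proof -
  have "tip ` {..<k} \<subseteq> V" using tip by auto
  then show ?thesis
    unfolding base_def using card_V card_image[OF inj_tip] finite_V
    by (subst card_Diff_subset) (auto intro: finite_subset)
qed

lemma origin: "origin \<in> base"
  unfolding origin_def using card_base by (intro someI_ex[of "\<lambda>v. v \<in> base"]) (metis add_is_0 card.empty ex_in_conv one_neq_zero)

lemma axis: "bij_betw axis (base - {origin}) {..<d}"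
proof -
  have "card (base - {origin}) = card {..<d}" using card_base origin by simp
  then have "\<exists>f. bij_betw f (base - {origin}) {..<d}"
    using finite_base by (intro finite_same_card_bij) auto
  then show ?thesis unfolding axis_def by (rule someI_ex)
qed

lemma rest_sub: "j < k \<Longrightarrow> rest j \<subseteq> base"
  unfolding rest_def base_def using tip by force

lemma finite_rest: "finite (rest j)"
  using finite_V by (auto simp: rest_def)

lemma card_rest: assumes "j < k" shows "0 < card (rest j)" "card (rest j) \<le> card V"
proof -
  have "card (rest j) = card {v \<in> V. c v = j} - 1"
    unfolding rest_def using tip[OF assms] by (subst card_Diff_singleton) auto
  then show "0 < card (rest j)" using class_ge_2[OF assms] by linarith
  show "card (rest j) \<le> card V" using finite_V by (intro card_mono) (auto simp: rest_def)
qed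

lemma tip_rest: "tip j \<notin> rest j" by (simp add: rest_def)

lemma sum_dep:
  assumes "j < k"
  shows "(\<Sum>v\<in>V. dep j v * g v) = g (tip j) - (\<Sum>v\<in>rest j. g v) / card (rest j)"
proof -
  have "(\<Sum>v\<in>V. dep j v * g v) = (\<Sum>v\<in>insert (tip j) (rest j). dep j v * g v)"
    using finite_V tip[OF assms] by (intro sum.mono_neutral_right) (auto simp: dep_def rest_def)
  also have "\<dots> = g (tip j) + (\<Sum>v\<in>rest j. dep j v * g v)"
    using finite_rest tip_rest by (subst sum.insert) (auto simp: dep_def)
  also have "(\<Sum>v\<in>rest j. dep j v * g v) = (\<Sum>v\<in>rest j. - (g v / card (rest j)))"
    using tip_rest by (intro sum.cong) (auto simp: dep_def)
  finally show ?thesis by (simp add: sum_negf sum_divide_distrib)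
qed

lemma dep_affine:
  assumes "j < k"
  shows "(\<Sum>v\<in>V. dep j v) = 0" "(\<Sum>v\<in>V. dep j v * config v i) = 0"
proof -
  show "(\<Sum>v\<in>V. dep j v) = 0"
    using sum_dep[OF assms, of "\<lambda>_. 1"] card_rest[OF assms] by simp
  have "tip j \<notin> base" using assms by (simp add: base_def)
  moreover have "(\<Sum>v\<in>rest j. config v i) = (\<Sum>v\<in>rest j. vertex v i)"
    using rest_sub[OF assms] by (intro sum.cong) (auto simp: config_def)
  ultimately show "(\<Sum>v\<in>V. dep j v * config v i) = 0"
    using tip[OF assms] by (simp add: sum_dep[OF assms] config_def)
qed

lemma dep_bounds:
  assumes "j < k"
  shows "\<bar>dep j v\<bar> \<le> 1" "v \<in> V \<Longrightarrow> c v = j \<Longrightarrow> 1 / card V \<le> \<bar>dep j v\<bar>"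
    "c v \<noteq> j \<Longrightarrow> dep j v = 0"
proof -
  have p: "0 < card (rest j)" "card (rest j) \<le> card V" using card_rest[OF assms] by auto
  then show "\<bar>dep j v\<bar> \<le> 1" by (auto simp: dep_def field_simps)
  show "v \<in> V \<Longrightarrow> c v = j \<Longrightarrow> 1 / card V \<le> \<bar>dep j v\<bar>"
    using p by (auto simp: dep_def rest_def field_simps frac_le)
  show "c v \<noteq> j \<Longrightarrow> dep j v = 0" using tip[OF assms] by (auto simp: dep_def rest_def)
qed

lemma rel_inner_config:
  assumes "u \<in> base - {origin}" "v \<in> base"
  shows "rel_inner d origin config u v = (if u = v then 1 else 0)"
proof -
  have u: "axis u < d" using axis assms(1) by (auto simp: bij_betw_def)
  have "vertex origin i = 0" for i by (simp add: vertex_def)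
  then have "rel_inner d origin config u v = (\<Sum>i<d. vertex u i * vertex v i)"
    using assms origin by (simp add: rel_inner_def config_def)
  also have "\<dots> = (\<Sum>i\<in>{axis u}. vertex u i * vertex v i)"
    using u by (intro sum.mono_neutral_right) (auto simp: vertex_def)
  also have "\<dots> = (if u = v then 1 else 0)"
    using assms axis by (auto simp: vertex_def bij_betw_def dest: inj_onD)
  finally show ?thesis .
qed

text \<open>The \<open>d + 2\<close> points at \<open>tip j\<close> and \<open>base\<close> have a
  dependency \<open>Y\<close> for \<open>x\<close>. Subtracting the multiple of \<open>dep j\<close>
  that agrees with it at the tip leaves a remainder \<open>Z\<close> on \<open>base\<close>, which
  is shown to be small; dividing by \<open>Y (tip j)\<close> gives the result.\<close>

lemma dependency_near:
  fixes \<epsilon> :: real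
  assumes j: "j < k" and \<epsilon>: "(real (card V))\<^sup>2 * \<epsilon> \<le> 1 / 2"
    and close: "\<And>u v. u \<in> V \<Longrightarrow> v \<in> V \<Longrightarrow>
        \<bar>rel_inner d origin x u v - rel_inner d origin config u v\<bar> \<le> \<epsilon>"
  obtains Y where "(\<Sum>v\<in>V. Y v) = 0" "\<And>i. i < d \<Longrightarrow> (\<Sum>v\<in>V. Y v * x v i) = 0"
    "\<And>v. \<bar>Y v - dep j v\<bar> \<le> 2 * (real (card V))\<^sup>2 * \<epsilon>"
proof -
  define n where "n = real (card V)"
  have "origin \<in> V" using origin base_sub by auto
  then have "card V > 0" using finite_V by (auto simp: card_gt_0_iff)
  then have n1: "n \<ge> 1" by (simp add: n_def)
  have \<epsilon>0: "\<epsilon> \<ge> 0" using close[OF \<open>origin \<in> V\<close> \<open>origin \<in> V\<close>] by linarith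
  let ?S = "insert (tip j) base"
  have tb: "tip j \<notin> base" using j by (simp add: base_def)
  have SV: "?S \<subseteq> V" using base_sub tip(1)[OF j] by auto
  have "d + 1 < card ?S" "finite ?S" using tb finite_base card_base by auto
  from exists_affine_dependency[OF this(2,1), of x] obtain Y where
    Y: "\<And>v. v \<notin> ?S \<Longrightarrow> Y v = 0" "\<exists>v\<in>?S. Y v \<noteq> 0" "(\<Sum>v\<in>?S. Y v) = 0"
      "\<And>i. i < d \<Longrightarrow> (\<Sum>v\<in>?S. Y v * x v i) = 0" by blast
  have Ysum: "(\<Sum>v\<in>V. Y v) = 0"
    using Y(1,3) SV finite_V by (subst sum.mono_neutral_right[of V ?S]) auto
  have Yx: "(\<Sum>v\<in>V. Y v * x v i) = 0" if "i < d" for i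
    using Y(1) Y(4)[OF that] SV finite_V by (subst sum.mono_neutral_right[of V ?S]) auto
  define m where "m = Max ((\<lambda>v. \<bar>Y v\<bar>) ` V)"
  have m_ge: "\<bar>Y v\<bar> \<le> m" if "v \<in> V" for v
    unfolding m_def using finite_V that by (intro Max_ge) auto
  have "m \<in> (\<lambda>v. \<bar>Y v\<bar>) ` V"
    unfolding m_def using finite_V \<open>origin \<in> V\<close> by (intro Max_in) auto
  then obtain v0 where v0: "v0 \<in> V" "m = \<bar>Y v0\<bar>" by blast
  obtain v1 where "v1 \<in> V" "Y v1 \<noteq> 0" using Y(2) SV by blast
  then have m0: "m > 0" using m_ge[of v1] by simp
  define Z where "Z v = Y v - Y (tip j) * dep j v" for v
  have Z0: "Z v = 0" if "v \<notin> base" for v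
    using that Y(1)[of v] rest_sub[OF j] by (cases "v = tip j") (auto simp: Z_def dep_def)
  have Zsum: "(\<Sum>v\<in>base. Z v) = 0"
  proof -
    have "(\<Sum>v\<in>base. Z v) = (\<Sum>v\<in>V. Z v)"
      using Z0 base_sub finite_V by (intro sum.mono_neutral_left) auto
    also have "\<dots> = 0"
      using Ysum dep_affine(1)[OF j] by (simp add: Z_def sum_subtractf flip: sum_distrib_left)
    finally show ?thesis .
  qed
  \<comment> \<open>On \<open>base\<close> without \<open>origin\<close> the Gram matrix of
    \<open>config\<close> is the identity, so pairing \<open>Z\<close> with row \<open>u\<close>
    returns \<open>Z u\<close>. As \<open>dep j\<close> is annihilated by this matrix and
    \<open>Y\<close> by that of \<open>x\<close>, only the difference of the two matrices
    remains.\<close>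
  have Zu: "\<bar>Z u\<bar> \<le> n * (m * \<epsilon>)" if u: "u \<in> base - {origin}" for u
  proof -
    let ?h = "rel_inner d origin config u" and ?g = "rel_inner d origin x u"
    have "Z u = (\<Sum>v\<in>base. if u = v then Z v else 0)"
      using u finite_base by simp
    also have "\<dots> = (\<Sum>v\<in>base. Z v * ?h v)"
      using rel_inner_config[OF u] by (intro sum.cong) auto
    also have "\<dots> = (\<Sum>v\<in>V. Z v * ?h v)"
      using Z0 base_sub finite_V by (intro sum.mono_neutral_left) auto
    also have "\<dots> = (\<Sum>v\<in>V. Y v * ?h v) - Y (tip j) * (\<Sum>v\<in>V. dep j v * ?h v)"
      by (simp add: Z_def sum_subtractf sum_distrib_left algebra_simps)
    also have "\<dots> = (\<Sum>v\<in>V. Y v * ?h v) - (\<Sum>v\<in>V. Y v * ?g v)"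
      using rel_inner_dependency[OF Ysum Yx, where b = origin and u = u]
        rel_inner_dependency[OF dep_affine[OF j], where b = origin and u = u and d = d] by simp
    also have "\<dots> = (\<Sum>v\<in>V. Y v * (?h v - ?g v))"
      by (simp add: sum_subtractf algebra_simps)
    finally have "Z u = (\<Sum>v\<in>V. Y v * (?h v - ?g v))" .
    then have "\<bar>Z u\<bar> \<le> (\<Sum>v\<in>V. \<bar>Y v * (?h v - ?g v)\<bar>)"
      by (simp only: sum_abs)
    also have "\<dots> \<le> (\<Sum>v\<in>V. m * \<epsilon>)"
    proof (rule sum_mono)
      fix v assume v: "v \<in> V"
      have "\<bar>?h v - ?g v\<bar> \<le> \<epsilon>"
        using close[of u v] u v base_sub by (subst abs_minus_commute) auto
      then show "\<bar>Y v * (?h v - ?g v)\<bar> \<le> m * \<epsilon>"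
        unfolding abs_mult using m_ge[OF v] m0 by (intro mult_mono) auto
    qed
    also have "\<dots> = n * (m * \<epsilon>)" by (simp add: n_def)
    finally show ?thesis .
  qed
  have nn: "n * (m * \<epsilon>) \<le> n\<^sup>2 * (m * \<epsilon>)"
    using n1 m0 \<epsilon>0 by (intro mult_right_mono) (auto simp: power2_eq_square)
  have Zb: "\<bar>Z v\<bar> \<le> n\<^sup>2 * (m * \<epsilon>)" for v
  proof -
    consider "v \<notin> base" | "v \<in> base - {origin}" | "v = origin" by blast
    then show ?thesis
    proof cases
      case 1
      then show ?thesis using Z0 m0 \<epsilon>0 by simp
    next
      case 2
      then show ?thesis using Zu[of v] nn by linarith
    next
      case 3
      have "Z origin = - (\<Sum>u\<in>base - {origin}. Z u)"
        using Zsum sum.remove[OF finite_base origin, of Z] by simp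
      then have "\<bar>Z origin\<bar> \<le> (\<Sum>u\<in>base - {origin}. \<bar>Z u\<bar>)" by simp
      also have "\<dots> \<le> card (base - {origin}) * (n * (m * \<epsilon>))"
        using Zu by (rule sum_bounded_above)
      also have "\<dots> \<le> n * (n * (m * \<epsilon>))"
      proof (rule mult_right_mono)
        show "real (card (base - {origin})) \<le> n"
          unfolding n_def using base_sub finite_V by (intro of_nat_mono card_mono) auto
      qed (use n1 m0 \<epsilon>0 in auto)
      finally show ?thesis using 3 by (simp add: power2_eq_square mult.assoc)
    qed
  qed
  have \<epsilon>': "n\<^sup>2 * \<epsilon> \<le> 1 / 2" using \<epsilon> by (simp add: n_def)
  \<comment> \<open>At a vertex where \<open>Y\<close> is largest, the remainder accounts for at
    most half of \<open>m\<close>, so the tip must carry the other half.\<close>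
  have tipm: "m / 2 \<le> \<bar>Y (tip j)\<bar>"
  proof -
    have "m \<le> \<bar>Z v0\<bar> + \<bar>Y (tip j) * dep j v0\<bar>" using v0 by (simp add: Z_def)
    moreover have "\<bar>Y (tip j) * dep j v0\<bar> \<le> \<bar>Y (tip j)\<bar>"
      using dep_bounds(1)[OF j, of v0] by (simp add: abs_mult mult_left_le)
    moreover have "\<bar>Z v0\<bar> \<le> m * (n\<^sup>2 * \<epsilon>)" using Zb[of v0] by (simp add: mult_ac)
    moreover have "m * (n\<^sup>2 * \<epsilon>) \<le> m * (1 / 2)" using \<epsilon>' m0 by (intro mult_left_mono) auto
    ultimately show ?thesis by linarith
  qed
  then have nz: "Y (tip j) \<noteq> 0" using m0 by auto
  show ?thesis
  proof (rule that[of "\<lambda>v. Y v / Y (tip j)"])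
    show "(\<Sum>v\<in>V. Y v / Y (tip j)) = 0" using Ysum by (simp flip: sum_divide_distrib)
    show "(\<Sum>v\<in>V. Y v / Y (tip j) * x v i) = 0" if "i < d" for i
      using Yx[OF that] by (simp flip: sum_divide_distrib)
    show "\<bar>Y v / Y (tip j) - dep j v\<bar> \<le> 2 * (real (card V))\<^sup>2 * \<epsilon>" for v
    proof -
      have "\<bar>Y v / Y (tip j) - dep j v\<bar> = \<bar>Z v\<bar> / \<bar>Y (tip j)\<bar>"
        using nz by (simp add: Z_def field_simps flip: abs_divide)
      also have "\<dots> \<le> (n\<^sup>2 * (m * \<epsilon>)) / (m / 2)"
        using Zb[of v] tipm m0 \<epsilon>0 by (intro frac_le) auto
      also have "\<dots> = 2 * (real (card V))\<^sup>2 * \<epsilon>" using m0 by (simp add: n_def)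
      finally show ?thesis .
    qed
  qed
qed

text \<open>
  With \<open>n = card V\<close>, each \<open>dep\<close> is perturbed by at most \<open>\<eta> = 2 / (7 n\<^sup>4)\<close>, so the \<open>n\<^sup>2\<close> error terms add up
  to at most \<open>3 n\<^sup>2 \<eta> = 6 / (7 n\<^sup>2)\<close> times the maximum of \<open>\<bar>f\<bar>\<close>, less than the main coefficient \<open>1 / n\<^sup>2\<close>.
\<close>

lemma length_velocity_zero:
  assumes close: "\<And>u v. u \<in> V \<Longrightarrow> v \<in> V \<Longrightarrow>
        \<bar>rel_inner d origin x u v - rel_inner d origin config u v\<bar> \<le> 1 / (7 * real (card V) ^ 6)"
    and zero: "\<And>u v. u \<in> V \<Longrightarrow> v \<in> V \<Longrightarrow> \<not> H u v \<Longrightarrow> length_velocity d x z u v = 0"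
    and "u \<in> V" "v \<in> V"
  shows "length_velocity d x z u v = 0"
proof -
  let ?f = "length_velocity d x z"
  define n where "n = real (card V)"
  have "card V > 0" using \<open>u \<in> V\<close> finite_V by (auto simp: card_gt_0_iff)
  then have n1: "n \<ge> 1" by (simp add: n_def)
  define \<epsilon> where "\<epsilon> = 1 / (7 * n ^ 6)"
  define \<eta> where "\<eta> = 2 * n\<^sup>2 * \<epsilon>"
  have \<eta>: "\<eta> = 2 / (7 * n ^ 4)" using n1 by (simp add: \<eta>_def \<epsilon>_def field_simps eval_nat_numeral)
  have "n ^ 4 \<ge> 1" using n1 by simp
  then have \<eta>1: "0 \<le> \<eta>" "\<eta> \<le> 1" by (auto simp: \<eta> divide_le_eq)
  have "(real (card V))\<^sup>2 * \<epsilon> \<le> 1 / 2" using \<eta>1(2) by (simp add: \<eta>_def n_def)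
  moreover have "\<bar>rel_inner d origin x u v - rel_inner d origin config u v\<bar> \<le> \<epsilon>"
    if "u \<in> V" "v \<in> V" for u v using close[OF that] by (simp add: \<epsilon>_def n_def)
  note near = this and small = calculation
  \<comment> \<open>The condition on \<open>j\<close> stays under the existential so that
    \<open>choice\<close> yields a single family.\<close>
  have "\<exists>Y. j < k \<longrightarrow> (\<Sum>v\<in>V. Y v) = 0 \<and> (\<forall>i<d. (\<Sum>v\<in>V. Y v * x v i) = 0) \<and>
      (\<forall>v. \<bar>Y v - dep j v\<bar> \<le> \<eta>)" for j
  proof (cases "j < k")
    case True
    show ?thesis
      by (rule dependency_near[OF True small near]) (auto simp: \<eta>_def n_def)
  qed simp
  then have "\<exists>Y. \<forall>j. j < k \<longrightarrow> (\<Sum>v\<in>V. Y j v) = 0 \<and> (\<forall>i<d. (\<Sum>v\<in>V. Y j v * x v i) = 0) \<and>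
      (\<forall>v. \<bar>Y j v - dep j v\<bar> \<le> \<eta>)"
    by (intro choice allI)
  then obtain Y where Y: "\<And>j. j < k \<Longrightarrow> (\<Sum>v\<in>V. Y j v) = 0"
    "\<And>j i. j < k \<Longrightarrow> i < d \<Longrightarrow> (\<Sum>v\<in>V. Y j v * x v i) = 0"
    "\<And>j v. j < k \<Longrightarrow> \<bar>Y j v - dep j v\<bar> \<le> \<eta>" by blast
  define M where "M = Max ((\<lambda>(u, v). \<bar>?f u v\<bar>) ` (V \<times> V))"
  have M_ge: "\<bar>?f u v\<bar> \<le> M" if "u \<in> V" "v \<in> V" for u v
    unfolding M_def using finite_V that by (intro Max_ge) auto
  have "M \<in> (\<lambda>(u, v). \<bar>?f u v\<bar>) ` (V \<times> V)"
    unfolding M_def using finite_V \<open>u \<in> V\<close> by (intro Max_in) auto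
  then obtain a b where ab: "a \<in> V" "b \<in> V" "M = \<bar>?f a b\<bar>" by auto
  have "M = 0"
  proof (rule ccontr)
    assume "M \<noteq> 0"
    then have M0: "M > 0" using ab by auto
    then have Hab: "H a b" using ab zero[of a b] by auto
    \<comment> \<open>Testing with the colours of a maximising pair isolates that pair: no other
      pair in \<open>H\<close> has these colours in this order.\<close>
    let ?i = "c a" and ?j = "c b"
    have ij: "?i < k" "?j < k" using colours ab by auto
    let ?T = "\<lambda>u v. dep ?i u * dep ?j v * ?f u v"
    have T0: "?T u v = 0" if uv: "u \<in> V" "v \<in> V" "(u, v) \<noteq> (a, b)" for u v
    proof (cases "c u = ?i \<and> c v = ?j \<and> H u v")
      case True
      then show ?thesis using H_colours[of u v a b] Hab ab(1,2) that by blast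
    next
      case False
      then consider "dep ?i u = 0" | "dep ?j v = 0" | "?f u v = 0"
        using dep_bounds(3)[OF ij(1)] dep_bounds(3)[OF ij(2)] zero[OF uv(1,2)] by blast
      then show ?thesis by cases auto
    qed
    have "(\<Sum>u\<in>V. \<Sum>v\<in>V. ?T u v) = (\<Sum>(u, v)\<in>V \<times> V. ?T u v)"
      by (rule sum.cartesian_product)
    also have "\<dots> = (\<Sum>(u, v)\<in>{(a, b)}. ?T u v)"
    proof (rule sum.mono_neutral_right)
      show "\<forall>w\<in>V \<times> V - {(a, b)}. (case w of (u, v) \<Rightarrow> ?T u v) = 0"
      proof
        fix w assume "w \<in> V \<times> V - {(a, b)}"
        then obtain u v where w: "w = (u, v)" "u \<in> V" "v \<in> V" "(u, v) \<noteq> (a, b)" by blast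
        show "(case w of (u, v) \<Rightarrow> ?T u v) = 0"
          unfolding w(1) prod.case by (rule T0[OF w(2-4)])
      qed
    qed (use finite_V ab in auto)
    finally have main: "(\<Sum>u\<in>V. \<Sum>v\<in>V. ?T u v) = ?T a b" by simp
    have lower: "1 / n * (1 / n) * M \<le> \<bar>?T a b\<bar>"
      unfolding abs_mult ab(3)[symmetric]
      using dep_bounds(2)[OF ij(1) ab(1)] dep_bounds(2)[OF ij(2) ab(2)] M0
      by (intro mult_mono) (auto simp: n_def)
    have "?T a b = (\<Sum>u\<in>V. \<Sum>v\<in>V. ?T u v) - (\<Sum>u\<in>V. \<Sum>v\<in>V. Y ?i u * Y ?j v * ?f u v)"
      using length_velocity_orthogonal[OF Y(1,2)[OF ij(1)] Y(1,2)[OF ij(2)], where z = z] main by simp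
    also have "\<dots> = (\<Sum>u\<in>V. \<Sum>v\<in>V. (dep ?i u * dep ?j v - Y ?i u * Y ?j v) * ?f u v)"
      by (simp add: sum_subtractf left_diff_distrib)
    finally have "\<bar>?T a b\<bar> \<le> (\<Sum>u\<in>V. \<bar>\<Sum>v\<in>V. (dep ?i u * dep ?j v - Y ?i u * Y ?j v) * ?f u v\<bar>)"
      by (simp only: sum_abs)
    also have "\<dots> \<le> (\<Sum>u\<in>V. \<Sum>v\<in>V. \<bar>(dep ?i u * dep ?j v - Y ?i u * Y ?j v) * ?f u v\<bar>)"
      by (intro sum_mono sum_abs)
    also have "\<dots> \<le> (\<Sum>u\<in>V. \<Sum>v\<in>V. 3 * \<eta> * M)"
    proof (intro sum_mono)
      fix u v assume uv: "u \<in> V" "v \<in> V"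
      have "dep ?i u * dep ?j v - Y ?i u * Y ?j v
          = dep ?i u * (dep ?j v - Y ?j v) + (dep ?i u - Y ?i u) * Y ?j v"
        by (simp add: algebra_simps)
      then have "\<bar>dep ?i u * dep ?j v - Y ?i u * Y ?j v\<bar> \<le> \<bar>dep ?i u\<bar> * \<bar>dep ?j v - Y ?j v\<bar> + \<bar>dep ?i u - Y ?i u\<bar> * \<bar>Y ?j v\<bar>"
        by (metis abs_mult abs_triangle_ineq)
      also have "\<dots> \<le> 1 * \<eta> + \<eta> * 2"
      proof (intro add_mono mult_mono)
        show "\<bar>Y ?j v\<bar> \<le> 2" using Y(3)[OF ij(2), of v] dep_bounds(1)[OF ij(2), of v] \<eta>1 by linarith
        show "\<bar>dep ?j v - Y ?j v\<bar> \<le> \<eta>" "\<bar>dep ?i u - Y ?i u\<bar> \<le> \<eta>"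
          using Y(3)[OF ij(2), of v] Y(3)[OF ij(1), of u] by linarith+
      qed (use dep_bounds(1)[OF ij(1)] \<eta>1 in auto)
      finally show "\<bar>(dep ?i u * dep ?j v - Y ?i u * Y ?j v) * ?f u v\<bar> \<le> 3 * \<eta> * M"
        unfolding abs_mult using M_ge[OF uv] \<eta>1 by (intro mult_mono) auto
    qed
    also have "\<dots> = n * n * (3 * (2 / (7 * n ^ 4)) * M)"
      by (simp add: n_def \<eta>)
    also have "\<dots> = 6 / 7 * (1 / n * (1 / n) * M)"
      using n1 by (simp add: field_simps eval_nat_numeral)
    finally have "1 / n * (1 / n) * M \<le> 6 / 7 * (1 / n * (1 / n) * M)"
      by (rule order_trans[OF lower])
    moreover have "1 / n * (1 / n) * M > 0" using n1 M0 by simp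
    ultimately show False by simp
  qed
  then show ?thesis using M_ge[of u v] assms by simp
qed

end

section \<open>Continuous motions\<close>

definition sq_dist :: "nat \<Rightarrow> ('a \<Rightarrow> nat \<Rightarrow> real) \<Rightarrow> 'a \<Rightarrow> 'a \<Rightarrow> real" where
  "sq_dist d x u v = (\<Sum>i<d. (x u i - x v i)\<^sup>2)"

lemma edist_eq_iff: "edist d (x u) (x v) = edist d (y u) (y v) \<longleftrightarrow> sq_dist d x u v = sq_dist d y u v"
  by (simp add: edist_def L2_set_def sq_dist_def)

text \<open>Polarisation: equal distances give equal Gram matrices.\<close>

lemma rel_inner_sq_dist:
  "rel_inner d b x u v = (sq_dist d x b u + sq_dist d x b v - sq_dist d x u v) / 2"
proof -
  have "2 * rel_inner d b x u v = sq_dist d x b u + sq_dist d x b v - sq_dist d x u v"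
    unfolding rel_inner_def sq_dist_def sum_distrib_left sum.distrib[symmetric] sum_subtractf[symmetric]
    by (rule sum.cong) (auto simp: power2_eq_square algebra_simps)
  then show ?thesis by simp
qed

lemma length_velocity_midpoint:
  "length_velocity d (\<lambda>v i. (x v i + y v i) / 2) (\<lambda>v i. y v i - x v i) u v =
     (sq_dist d y u v - sq_dist d x u v) / 2"
  unfolding length_velocity_def sq_dist_def sum_subtractf[symmetric] sum_divide_distrib
  by (rule sum.cong) (auto simp: power2_eq_square field_simps)

lemma rel_inner_perturb:
  assumes "finite V" "b \<in> V" "e > 0"
  obtains \<delta> where "\<delta> > 0"
    "\<And>p u v. (\<And>v i. v \<in> V \<Longrightarrow> i < d \<Longrightarrow> \<bar>p v i - x v i\<bar> < \<delta>) \<Longrightarrow> u \<in> V \<Longrightarrow> v \<in> V \<Longrightarrow>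
       \<bar>rel_inner d b p u v - rel_inner d b x u v\<bar> \<le> e"
proof -
  define K where "K = (\<Sum>v\<in>V. \<Sum>i<d. \<bar>x v i\<bar>)"
  have K: "\<bar>x v i\<bar> \<le> K" if "v \<in> V" "i < d" for v i
  proof -
    have "\<bar>x v i\<bar> \<le> (\<Sum>i<d. \<bar>x v i\<bar>)"
      using that by (intro member_le_sum) auto
    also have "\<dots> \<le> K"
      unfolding K_def using that \<open>finite V\<close> by (intro member_le_sum[of v]) (auto intro: sum_nonneg)
    finally show ?thesis .
  qed
  have K0: "K \<ge> 0" unfolding K_def by (intro sum_nonneg) auto
  \<comment> \<open>The factor \<open>8 * K + 4\<close> comes from
    \<open>(2 * \<delta>) * (2 * K + 2) + (2 * K) * (2 * \<delta>)\<close>, where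
    \<open>\<delta> \<le> 1\<close> is used. The \<open>+ 1\<close> next to \<open>d\<close> keeps
    the denominator positive for \<open>d = 0\<close>.\<close>
  define \<delta> where "\<delta> = min 1 (e / ((8 * K + 4) * (real d + 1)))"
  have \<delta>0: "\<delta> > 0" "\<delta> \<le> 1" using K0 \<open>e > 0\<close> by (auto simp: \<delta>_def intro!: divide_pos_pos mult_pos_pos)
  have "\<delta> \<le> e / ((8 * K + 4) * (real d + 1))" by (simp add: \<delta>_def)
  then have \<delta>e: "(real d + 1) * ((8 * K + 4) * \<delta>) \<le> e"
    using K0 by (subst (asm) pos_le_divide_eq) (auto simp: mult_ac intro!: mult_pos_pos)
  show ?thesis
  proof (rule that[OF \<delta>0(1)])
    fix p u v assume p: "\<And>v i. v \<in> V \<Longrightarrow> i < d \<Longrightarrow> \<bar>p v i - x v i\<bar> < \<delta>" and uv: "u \<in> V" "v \<in> V"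
    have "\<bar>rel_inner d b p u v - rel_inner d b x u v\<bar> \<le>
        (\<Sum>i<d. \<bar>(p u i - p b i) * (p v i - p b i) - (x u i - x b i) * (x v i - x b i)\<bar>)"
      unfolding rel_inner_def sum_subtractf[symmetric] by (rule sum_abs)
    also have "\<dots> \<le> (\<Sum>i<d. (8 * K + 4) * \<delta>)"
    proof (rule sum_mono)
      fix i assume "i \<in> {..<d}"
      then have i: "i < d" by simp
      note b = p[OF uv(1) i] p[OF uv(2) i] p[OF \<open>b \<in> V\<close> i] K[OF uv(1) i] K[OF uv(2) i] K[OF \<open>b \<in> V\<close> i]
      let ?A = "p u i - p b i" and ?B = "p v i - p b i" and ?a = "x u i - x b i" and ?b = "x v i - x b i"
      have "?A * ?B - ?a * ?b = (?A - ?a) * ?B + ?a * (?B - ?b)" by (simp add: algebra_simps)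
      then have "\<bar>?A * ?B - ?a * ?b\<bar> \<le> \<bar>?A - ?a\<bar> * \<bar>?B\<bar> + \<bar>?a\<bar> * \<bar>?B - ?b\<bar>" by (metis abs_mult abs_triangle_ineq)
      also have "\<dots> \<le> (2 * \<delta>) * (2 * K + 2) + (2 * K) * (2 * \<delta>)"
      proof (intro add_mono mult_mono)
        show "\<bar>?A - ?a\<bar> \<le> 2 * \<delta>" "\<bar>?B - ?b\<bar> \<le> 2 * \<delta>" "\<bar>?a\<bar> \<le> 2 * K" "\<bar>?B\<bar> \<le> 2 * K + 2"
          using b \<delta>0 by linarith+
      qed (use K0 \<delta>0 in auto)
      finally show "\<bar>?A * ?B - ?a * ?b\<bar> \<le> (8 * K + 4) * \<delta>" by (simp add: algebra_simps)
    qed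
    also have "\<dots> \<le> (real d + 1) * ((8 * K + 4) * \<delta>)"
      using K0 \<delta>0 by (simp add: algebra_simps)
    finally show "\<bar>rel_inner d b p u v - rel_inner d b x u v\<bar> \<le> e" using \<delta>e by linarith
  qed
qed

context collapsed_simplex begin

text \<open>The times at which all distances have their initial values form a nonempty, closed and
  open subset of the unit interval. The tolerance is half of that in
  \<open>length_velocity_zero\<close>; the other half is spent on the midpoint.\<close>

lemma rigid_framework_near:
  assumes E: "\<And>u v. u \<in> V \<Longrightarrow> v \<in> V \<Longrightarrow> u \<noteq> v \<Longrightarrow> \<not> H u v \<Longrightarrow> {u, v} \<in> E"
    and close: "\<And>u v. u \<in> V \<Longrightarrow> v \<in> V \<Longrightarrow>
        \<bar>rel_inner d origin p u v - rel_inner d origin config u v\<bar> \<le> 1 / (14 * real (card V) ^ 6)"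
  shows "rigid_framework d V E p"
  unfolding rigid_framework_def edist_eq_iff
proof (intro allI impI, elim conjE)
  fix q :: "real \<Rightarrow> 'a \<Rightarrow> nat \<Rightarrow> real"
  assume motion: "continuous_motion d V p q"
    and edges: "\<forall>t\<in>{0..1}. \<forall>u v. {u, v} \<in> E \<longrightarrow> sq_dist d (q t) u v = sq_dist d p u v"
  have q0: "q 0 v i = p v i" and cont: "continuous_on {0..1} (\<lambda>t. q t v i)" if "v \<in> V" "i < d" for v i
    using motion that by (auto simp: continuous_motion_def)
  have oV: "origin \<in> V" using origin base_sub by auto
  then have cV: "real (card V) > 0" using finite_V by (auto simp: card_gt_0_iff)
  define G where "G t = (\<Sum>u\<in>V. \<Sum>v\<in>V. (sq_dist d (q t) u v - sq_dist d p u v)\<^sup>2)" for t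
  have G0: "G t = 0 \<longleftrightarrow> (\<forall>u\<in>V. \<forall>v\<in>V. sq_dist d (q t) u v = sq_dist d p u v)" for t
    unfolding G_def using finite_V by (simp add: sum_nonneg_eq_0_iff sum_nonneg)
  define S where "S = {t \<in> {0..1}. G t = 0}"
  have "continuous_on {0..1} G"
    unfolding G_def sq_dist_def by (intro continuous_intros cont) auto
  then have "closedin (top_of_set {0..1}) S"
    unfolding S_def by (rule continuous_closedin_preimage_constant)
  moreover have "openin (top_of_set {0..1}) S"
    unfolding openin_euclidean_subtopology_iff
  proof (intro conjI ballI)
    fix s assume "s \<in> S"
    then have s: "s \<in> {0..1}" "\<forall>u\<in>V. \<forall>v\<in>V. sq_dist d (q s) u v = sq_dist d p u v"
      by (auto simp: S_def G0)
    \<comment> \<open>The comparison is with \<open>q s\<close>, which may be far from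
      \<open>p\<close> but has the same Gram matrix; hence the midpoint stays within the tolerance
      for \<open>t\<close> near \<open>s\<close>.\<close>
    define mid where "mid t v i = (q s v i + q t v i) / 2" for t v i
    define F where "F t = (\<Sum>u\<in>V. \<Sum>v\<in>V. \<bar>rel_inner d origin (mid t) u v - rel_inner d origin p u v\<bar>)" for t
    have "continuous_on {0..1} F"
      unfolding F_def rel_inner_def mid_def by (intro continuous_intros cont oV) auto
    moreover have "F s = 0"
    proof -
      have "rel_inner d origin (mid s) u v = rel_inner d origin p u v" if "u \<in> V" "v \<in> V" for u v
        using s(2) that oV by (simp add: mid_def[abs_def] rel_inner_sq_dist)
      then show ?thesis by (simp add: F_def)
    qed
    moreover have "1 / (14 * real (card V) ^ 6) > 0" using cV by simp
    ultimately obtain e where e: "e > 0"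
        "\<And>t. t \<in> {0..1} \<Longrightarrow> dist t s < e \<Longrightarrow> \<bar>F t\<bar> < 1 / (14 * real (card V) ^ 6)"
      using s(1) unfolding continuous_on_iff dist_real_def by (metis diff_zero)
    have "t \<in> S" if t: "t \<in> {0..1}" "dist t s < e" for t
    proof -
      have near: "\<bar>rel_inner d origin (mid t) u v - rel_inner d origin config u v\<bar> \<le> 1 / (7 * real (card V) ^ 6)"
        if uv: "u \<in> V" "v \<in> V" for u v
      proof -
        let ?h = "\<lambda>u v. \<bar>rel_inner d origin (mid t) u v - rel_inner d origin p u v\<bar>"
        have "?h u v \<le> (\<Sum>v\<in>V. ?h u v)"
          using uv finite_V by (intro member_le_sum) auto
        also have "\<dots> \<le> F t"
          unfolding F_def using uv finite_V by (intro member_le_sum[of u]) (auto intro: sum_nonneg)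
        finally have "?h u v \<le> 1 / (14 * real (card V) ^ 6)" using e(2)[OF t] by simp
        moreover have "1 / (14 * real (card V) ^ 6) + 1 / (14 * real (card V) ^ 6) = 1 / (7 * real (card V) ^ 6)"
          by simp
        ultimately show ?thesis using close[OF uv] by linarith
      qed
      have "length_velocity d (mid t) (\<lambda>v i. q t v i - q s v i) u v = 0" if "u \<in> V" "v \<in> V" for u v
      proof (rule length_velocity_zero[OF near _ that])
        fix u v assume uv: "u \<in> V" "v \<in> V" "\<not> H u v"
        show "length_velocity d (mid t) (\<lambda>v i. q t v i - q s v i) u v = 0"
        proof (cases "u = v")
          case True
          then show ?thesis by (simp add: length_velocity_def)
        next
          case False
          then have "{u, v} \<in> E" using E uv by blast
          then show ?thesis
            using edges t(1) s(1) by (simp add: mid_def[abs_def] length_velocity_midpoint)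
        qed
      qed
      then have "\<forall>u\<in>V. \<forall>v\<in>V. sq_dist d (q t) u v = sq_dist d p u v"
        using s(2) by (simp add: mid_def[abs_def] length_velocity_midpoint)
      then show ?thesis using t(1) by (simp add: S_def G0)
    qed
    then show "\<exists>e>0. \<forall>t\<in>{0..1}. dist t s < e \<longrightarrow> t \<in> S" using e(1) by blast
  qed (auto simp: S_def)
  moreover have "0 \<in> S"
    unfolding S_def G0 using q0 by (auto simp: sq_dist_def)
  moreover have "connected {0..1::real}" by simp
  ultimately have "S = {0..1}" unfolding connected_clopen by blast
  then show "\<forall>t\<in>{0..1}. \<forall>u\<in>V. \<forall>v\<in>V. sq_dist d (q t) u v = sq_dist d p u v"
    unfolding S_def G0 by blast
qed

text \<open>The tolerance holds throughout a neighbourhood of \<open>config\<close>, which contains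
  a generic point.\<close>

lemma generically_rigid_complement:
  assumes "\<And>u v. u \<in> V \<Longrightarrow> v \<in> V \<Longrightarrow> u \<noteq> v \<Longrightarrow> \<not> H u v \<Longrightarrow> {u, v} \<in> E"
  shows "generically_rigid d V E"
proof -
  have oV: "origin \<in> V" using origin base_sub by auto
  then have "1 / (14 * real (card V) ^ 6) > 0" using finite_V by (auto simp: card_gt_0_iff)
  from rel_inner_perturb[OF finite_V oV this, of d config] obtain \<delta> where \<delta>: "\<delta> > 0"
    "\<And>p u v. (\<And>v i. v \<in> V \<Longrightarrow> i < d \<Longrightarrow> \<bar>p v i - config v i\<bar> < \<delta>) \<Longrightarrow> u \<in> V \<Longrightarrow> v \<in> V \<Longrightarrow>
       \<bar>rel_inner d origin p u v - rel_inner d origin config u v\<bar> \<le> 1 / (14 * real (card V) ^ 6)" by blast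
  obtain p where p: "generic d V p" "\<And>v i. v \<in> V \<Longrightarrow> i < d \<Longrightarrow> \<bar>p v i - config v i\<bar> < \<delta>"
    using generic_dense[OF finite_V \<delta>(1)] by blast
  have "rigid_framework d V E p"
    using assms \<delta>(2)[OF p(2)] by (rule rigid_framework_near)
  then show ?thesis using p(1) by (auto simp: generically_rigid_def)
qed

end

section \<open>From the minimum degree to the rigidity dimension\<close>

lemma card_non_neighbours:
  assumes G: "simple_graph V E" and "v \<in> V"
  shows "card {u \<in> V. u \<noteq> v \<and> {u, v} \<notin> E} + min_degree V E < card V"
proof -
  have finV: "finite V" using G by (simp add: simple_graph_def)
  let ?B = "{u \<in> V. u \<noteq> v \<and> {u, v} \<in> E}"
  have "bij_betw (\<lambda>u. {u, v}) ?B {e \<in> E. v \<in> e}"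
  proof (intro bij_betw_imageI set_eqI iffI)
    show "inj_on (\<lambda>u. {u, v}) ?B" by (auto simp: inj_on_def doubleton_eq_iff)
    fix e assume e: "e \<in> {e \<in> E. v \<in> e}"
    then have "card e = 2" "e \<subseteq> V" using G by (auto simp: simple_graph_def)
    then obtain a b where "e = {a, b}" "a \<noteq> b" by (meson card_2_iff)
    then show "e \<in> (\<lambda>u. {u, v}) ` ?B"
      using e \<open>e \<subseteq> V\<close> by (cases "a = v") (auto simp: insert_commute)
  qed auto
  then have "card ?B = vertex_degree E v"
    by (simp add: vertex_degree_def bij_betw_same_card)
  moreover have "min_degree V E \<le> vertex_degree E v"
    unfolding min_degree_def using finV \<open>v \<in> V\<close> by (intro Min_le) auto
  moreover have "card {u \<in> V. u \<noteq> v \<and> {u, v} \<notin> E} + card ?B = card (V - {v})"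
    using finV by (subst card_Un_disjoint[symmetric]) (auto intro!: arg_cong[where f = card])
  moreover have "card (V - {v}) < card V"
    using finV \<open>v \<in> V\<close> by (intro psubset_card_mono) auto
  ultimately show ?thesis by linarith
qed

text \<open>Colour classes are capped at \<open>s = 7\<close>, whence
  \<open>63 = 7 * (7 + 2)\<close>. The cap must exceed the average class size, which is about 6 for
  the intended \<open>k\<close>.\<close>

lemma rigidity_dim_ge:
  assumes G: "simple_graph V E" and deg: "card V \<le> min_degree V E + 1 + \<Delta>"
    and k: "7 * k > card V + 63 * \<Delta>\<^sup>2" "2 * k + 4 * \<Delta>\<^sup>2 \<le> card V" "k < card V"
  shows "card V - 1 - k \<le> rigidity_dim V E"
proof -
  have finV: "finite V" using G by (simp add: simple_graph_def)
  \<comment> \<open>Empty outside \<open>V\<close>, since the locale imposes its conditions at every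
    \<open>v\<close>.\<close>
  define N where "N v = (if v \<in> V then {u \<in> V. u \<noteq> v \<and> {u, v} \<notin> E} else {})" for v
  interpret bounded_degree V N \<Delta>
  proof
    fix v
    show "card (N v) \<le> \<Delta>"
      using card_non_neighbours[OF G, of v] deg by (auto simp: N_def)
  qed (use finV in \<open>auto simp: N_def insert_commute split: if_splits\<close>)
  obtain c where c: "c ` V \<subseteq> {..<k}" "harmonious_on N V c" "\<forall>j<k. 2 \<le> card {v \<in> V. c v = j}"
    using harmonious_colouring[of 7 k] k by auto
  interpret collapsed_simplex V c "\<lambda>u v. v \<in> N u" k "card V - 1 - k"
  proof
    show "u = u' \<and> v = v'" if "u \<in> V" "v \<in> V" "u' \<in> V" "v' \<in> V" "v \<in> N u" "v' \<in> N u'" "c u = c u'" "c v = c v'"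
      for u v u' v' using c(2) that unfolding harmonious_on_def by blast
  qed (use c finV k in auto)
  have "generically_rigid (card V - 1 - k) V E"
    by (rule generically_rigid_complement) (auto simp: N_def insert_commute)
  then show ?thesis
    unfolding rigidity_dim_def using k(3)
    by (intro Greatest_le_nat[where b = "card V"]) auto
qed

theorem corollary1p6:
  fixes \<Delta> :: "nat \<Rightarrow> real"
  assumes "\<And>n. 2 \<le> \<Delta> n"
    and "\<Delta> \<in> o(\<lambda>n. sqrt (real n))"
  shows "\<exists>(C::real) (n0::nat). \<forall>n\<ge>n0. \<forall>(V::'a set) (E::'a set set).
           simple_graph V E \<and> card V = n \<and> real (min_degree V E) \<ge> real n - 1 - \<Delta> n \<longrightarrow>
           real (rigidity_dim V E) \<ge>
             real n / 2 + real n / (\<Delta> n + 1) - C * (sqrt (real n) + (\<Delta> n)\<^sup>2)"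
proof -
  \<comment> \<open>The factor \<open>1 / 50\<close> turns into
    \<open>2500 * D\<^sup>2 \<le> n\<close>, so \<open>63 * D\<^sup>2\<close> is well below the
    excess of about \<open>n / 6\<close> of \<open>7 * (n div 6)\<close> over \<open>n\<close>;
    \<open>n \<ge> 1000\<close> absorbs the rounding.\<close>
  have "eventually (\<lambda>n. norm (\<Delta> n) \<le> 1 / 50 * norm (sqrt (real n))) at_top"
    using assms(2) by (rule landau_o.smallD) simp
  then obtain N0 where N0: "\<And>n. n \<ge> N0 \<Longrightarrow> \<bar>\<Delta> n\<bar> \<le> 1 / 50 * sqrt (real n)"
    by (auto simp: eventually_at_top_linorder)
  have "real (rigidity_dim V E) \<ge> real n / 2 + real n / (\<Delta> n + 1) - 1 * (sqrt (real n) + (\<Delta> n)\<^sup>2)"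
    if n: "n \<ge> max N0 1000" and G: "simple_graph V E" "card V = n"
      and deg: "real (min_degree V E) \<ge> real n - 1 - \<Delta> n"
    for n and V :: "'a set" and E
  proof -
    \<comment> \<open>Degrees are integers, so rounding the bound down loses nothing.\<close>
    define D where "D = nat \<lfloor>\<Delta> n\<rfloor>"
    have D: "real D \<le> \<Delta> n" "\<Delta> n < real D + 1" using assms(1)[of n] by (auto simp: D_def)
    have "(real D)\<^sup>2 \<le> (1 / 50 * sqrt (real n))\<^sup>2"
      using D(1) N0[of n] n by (intro power_mono) auto
    then have "2500 * (real D)\<^sup>2 \<le> real n" by (simp add: power_mult_distrib power_divide)
    then have D2: "2500 * D\<^sup>2 \<le> n" by (simp flip: of_nat_power of_nat_le_iff[where 'a = real])
    have deg': "card V \<le> min_degree V E + 1 + D" using deg D(2) G(2) by linarith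
    have "card V - 1 - n div 6 \<le> rigidity_dim V E"
      using n D2 G(2) by (intro rigidity_dim_ge[OF G(1) deg']) auto
    then have "real n - 1 - real n / 6 \<le> real (rigidity_dim V E)" using G(2) by linarith
    \<comment> \<open>From \<open>\<Delta> n \<ge> 2\<close> the two leading terms of the target
      total at most \<open>n / 2 + n / 3\<close>, that is \<open>n - n / 6\<close>. The remaining
      loss of 1 is covered by the square root, so \<open>C = 1\<close> suffices.\<close>
    moreover define X where "X = real n / (\<Delta> n + 1)"
    then have "X \<le> real n / 3"
      unfolding X_def using assms(1)[of n] by (intro divide_left_mono) auto
    moreover have "1 \<le> sqrt (real n)" using n by simp
    moreover have "0 \<le> (\<Delta> n)\<^sup>2" by simp
    ultimately show ?thesis unfolding X_def[symmetric] mult_1 by linarith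
  qed
  then show ?thesis by blast
qed

end
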